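(* Let $k\ge 1$, let $M\subset\mathbb{R}^n$ be a smooth domain with or without boundary and let $c\in C^k(M)$ be a (positive definite) stiffness tensor field such that the qP-branch of the slowness surface associated to $c$ is globally separate, i.e. for every $x\in M$ and every $p\in T_x^*M\setminus\{0\}$ the largest eigenvalue $\lambda^c_{qP}(x,p)$ of the Christoffel matrix $\Gamma_c(x,p)$ is simple. Then the associated Finsler function $F^c_{qP}$ is of class $C^k$ along the manifold and smooth on the fibers; that is, $F^c_{qP}\in C^k_\infty(TM\setminus\{0\})$.
   Context: Stiffness tensors: a real $n$-dimensional stiffness tensor is an array $c=(c_{ijkl})_{1\le i,j,k,l\le n}$ of real numbers with $c_{ijkl}=c_{jikl}=c_{klij}$; it is positive definite if $\sum c_{ijkl}A_{ij}A_{kl}>0$ for every nonzero real symmetric $n\times n$ matrix $A$. A stiffness tensor field on $M$ assigns to each $x\in M$ a stiffness tensor $c(x)$; it is of class $C^k(M)$ if all component functions are. Christoffel matrix: in the coordinates $(x,p)$ of $T^*M=M\times\mathbb{R}^n$, $(\Gamma_c)_{il}(x,p)=\sum_{j,k}c_{ijkl}(x)p_jp_k$, a symmetric matrix. Its largest eigenvalue is denoted $\lambda^c_{qP}(x,p)$. Finsler function: on $T^*M\setminus\{0\}$ (zero section removed) set $\ell(x,p)=\big(x,\partial_{p_1}(\tfrac12\lambda^c_{qP})(x,p),\dots,\partial_{p_n}(\tfrac12\lambda^c_{qP})(x,p)\big)\in TM\setminus\{0\}$ (the Legendre map of $\tfrac12\lambda^c_{qP}$). Then $F^c_{qP}:=(\lambda^c_{qP})^{1/2}\circ\ell^{-1}$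 on $TM\setminus\{0\}$, extended by $0$ to the zero section. Anisotropic regularity: for sets $V\subset\mathbb{R}^m$, $U\subset\mathbb{R}^{n}$, let $C^k(V\times U)$ (in this notation) be the functions that are $k$ times continuously differentiable with respect to the first variable $v\in V$, and $C_l(V\times U)$ those that are $l$ times continuously differentiable with respect to the second variable $u\in U$. For $1\le k\le l$, $C^k_l(V\times U)$ is the set of functions $f$ with (i) $f\in C^k(V\times U)\cap C_l(V\times U)$; (ii) $\partial_u^\alpha f\in C^{\min\{k,l-|\alpha|\}}(V\times U)$ for all $|\alpha|\le l$; (iii) $\partial_v^\alpha f\in C_{l-|\alpha|}(V\times U)$ for all $|\alpha|\le k$. $C^k_\infty$ is the class with $l=\infty$ (membership in $C^k_l$ for all $l\ge k$). Here $TM\setminus\{0\}=M\times(\mathbb{R}^n\setminus\{0\})$, with $x\in M$ the first variable and the fiber variable the second. *)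

theory Defs
  imports "HOL-Analysis.Analysis" "HOL-Computational_Algebra.Polynomial"
begin

text \<open>
  Derivatives are Frechet derivatives within the set, so that they also make sense at boundary
  points of a domain that contains (part of) its boundary. On the smooth domains defined below
  the derivative within the set is unique, and so the choice made by \<^const>\<open>frechet_derivative\<close>
  is harmless. On open sets these are the ordinary partial derivatives.
\<close>

definition partial_deriv ::
    "(real^'n) set \<Rightarrow> 'n::finite \<Rightarrow> (real^'n \<Rightarrow> real) \<Rightarrow> real^'n \<Rightarrow> real" where
  "partial_deriv S i f x = frechet_derivative f (at x within S) (axis i 1)"

text \<open>
  A multi-index is represented by the list of the coordinates in which one differentiates (last
  entry first); its order is the length of the list.
\<close>

fun partial_derivs ::
    "(real^'n) set \<Rightarrow> 'n::finite list \<Rightarrow> (real^'n \<Rightarrow> real) \<Rightarrow> real^'n \<Rightarrow> real" where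
  "partial_derivs S [] f = f"
| "partial_derivs S (i # \<alpha>) f = partial_deriv S i (partial_derivs S \<alpha> f)"

definition C_k_on :: "nat \<Rightarrow> (real^'n::finite) set \<Rightarrow> (real^'n \<Rightarrow> real) \<Rightarrow> bool" where
  "C_k_on k S f \<longleftrightarrow>
     (\<forall>\<alpha>. length \<alpha> < k \<longrightarrow> (\<forall>x\<in>S. partial_derivs S \<alpha> f differentiable (at x within S))) \<and>
     (\<forall>\<alpha>. length \<alpha> \<le> k \<longrightarrow> continuous_on S (partial_derivs S \<alpha> f))"

definition smooth_on :: "(real^'n::finite) set \<Rightarrow> (real^'n \<Rightarrow> real) \<Rightarrow> bool" where
  "smooth_on S f \<longleftrightarrow> (\<forall>k. C_k_on k S f)"

text \<open>
  A connected set that is locally either all of space or the superlevel set of a smooth function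
  with nonvanishing gradient; the boundary is the set \<open>M - interior M\<close>, which may be empty.
\<close>

definition smooth_domain :: "(real^'n::finite) set \<Rightarrow> bool" where
  "smooth_domain M \<longleftrightarrow> M \<noteq> {} \<and> connected M \<and>
     (\<forall>x \<in> M - interior M. \<exists>W \<rho>. open W \<and> x \<in> W \<and> smooth_on W \<rho> \<and>
        (\<forall>z\<in>W. \<exists>i. partial_deriv W i \<rho> z \<noteq> 0) \<and>
        M \<inter> W = {z \<in> W. \<rho> z \<ge> 0})"

definition partials_fst ::
    "(real^'m) set \<Rightarrow> 'm::finite list \<Rightarrow> (real^'m \<Rightarrow> real^'n \<Rightarrow> real) \<Rightarrow> real^'m \<Rightarrow> real^'n \<Rightarrow> real" where
  "partials_fst V \<alpha> f v u = partial_derivs V \<alpha> (\<lambda>w. f w u) v"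

definition partials_snd ::
    "(real^'n) set \<Rightarrow> 'n::finite list \<Rightarrow> (real^'m \<Rightarrow> real^'n \<Rightarrow> real) \<Rightarrow> real^'m \<Rightarrow> real^'n \<Rightarrow> real" where
  "partials_snd U \<alpha> f v u = partial_derivs U \<alpha> (f v) u"

text \<open>Continuity of the derivatives in one variable is joint continuity in both variables.\<close>

definition C_fst ::
    "nat \<Rightarrow> (real^'m::finite) set \<Rightarrow> (real^'n::finite) set \<Rightarrow> (real^'m \<Rightarrow> real^'n \<Rightarrow> real) \<Rightarrow> bool" where
  "C_fst k V U f \<longleftrightarrow>
     (\<forall>\<alpha>. length \<alpha> < k \<longrightarrow>
        (\<forall>v\<in>V. \<forall>u\<in>U. (\<lambda>w. partials_fst V \<alpha> f w u) differentiable (at v within V))) \<and>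
     (\<forall>\<alpha>. length \<alpha> \<le> k \<longrightarrow> continuous_on (V \<times> U) (\<lambda>(v, u). partials_fst V \<alpha> f v u))"

definition C_snd ::
    "nat \<Rightarrow> (real^'m::finite) set \<Rightarrow> (real^'n::finite) set \<Rightarrow> (real^'m \<Rightarrow> real^'n \<Rightarrow> real) \<Rightarrow> bool" where
  "C_snd l V U f \<longleftrightarrow>
     (\<forall>\<alpha>. length \<alpha> < l \<longrightarrow>
        (\<forall>v\<in>V. \<forall>u\<in>U. partials_snd U \<alpha> f v differentiable (at u within U))) \<and>
     (\<forall>\<alpha>. length \<alpha> \<le> l \<longrightarrow> continuous_on (V \<times> U) (\<lambda>(v, u). partials_snd U \<alpha> f v u))"

definition C_aniso ::
    "nat \<Rightarrow> nat \<Rightarrow> (real^'m::finite) set \<Rightarrow> (real^'n::finite) set \<Rightarrow> (real^'m \<Rightarrow> real^'n \<Rightarrow> real) \<Rightarrow> bool" where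
  "C_aniso k l V U f \<longleftrightarrow>
     C_fst k V U f \<and> C_snd l V U f \<and>
     (\<forall>\<alpha>. length \<alpha> \<le> l \<longrightarrow> C_fst (min k (l - length \<alpha>)) V U (partials_snd U \<alpha> f)) \<and>
     (\<forall>\<alpha>. length \<alpha> \<le> k \<longrightarrow> C_snd (l - length \<alpha>) V U (partials_fst V \<alpha> f))"

definition C_aniso_inf ::
    "nat \<Rightarrow> (real^'m::finite) set \<Rightarrow> (real^'n::finite) set \<Rightarrow> (real^'m \<Rightarrow> real^'n \<Rightarrow> real) \<Rightarrow> bool" where
  "C_aniso_inf k V U f \<longleftrightarrow> (\<forall>l\<ge>k. C_aniso k l V U f)"

definition eigenvalues :: "real^'n^'n::finite \<Rightarrow> real set" where
  "eigenvalues A = {\<mu>. \<exists>v. v \<noteq> 0 \<and> A *v v = \<mu> *\<^sub>R v}"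

definition largest_eigenvalue :: "real^'n^'n::finite \<Rightarrow> real" where
  "largest_eigenvalue A = Max (eigenvalues A)"

definition charpoly :: "real^'n^'n::finite \<Rightarrow> real poly" where
  "charpoly A = det (\<chi> i j. (if i = j then [:0, 1:] else 0) - [:A $ i $ j:])"

definition simple_eigenvalue :: "real^'n^'n::finite \<Rightarrow> real \<Rightarrow> bool" where
  "simple_eigenvalue A \<mu> \<longleftrightarrow> \<mu> \<in> eigenvalues A \<and> order \<mu> (charpoly A) = 1"

type_synonym 'n tensor4 = "'n \<Rightarrow> 'n \<Rightarrow> 'n \<Rightarrow> 'n \<Rightarrow> real"

definition stiffness_tensor :: "'n tensor4 \<Rightarrow> bool" where
  "stiffness_tensor c \<longleftrightarrow> (\<forall>i j k l. c i j k l = c j i k l \<and> c i j k l = c k l i j)"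

definition positive_definite_tensor :: "'n::finite tensor4 \<Rightarrow> bool" where
  "positive_definite_tensor c \<longleftrightarrow>
     (\<forall>A :: real^'n^'n. transpose A = A \<and> A \<noteq> 0 \<longrightarrow>
        (\<Sum>i\<in>UNIV. \<Sum>j\<in>UNIV. \<Sum>k\<in>UNIV. \<Sum>l\<in>UNIV. c i j k l * A $ i $ j * A $ k $ l) > 0)"

definition C_k_tensor_field ::
    "nat \<Rightarrow> (real^'n::finite) set \<Rightarrow> (real^'n \<Rightarrow> 'n tensor4) \<Rightarrow> bool" where
  "C_k_tensor_field m M c \<longleftrightarrow> (\<forall>i j k l. C_k_on m M (\<lambda>x. c x i j k l))"

definition christoffel :: "(real^'n \<Rightarrow> 'n tensor4) \<Rightarrow> real^'n \<Rightarrow> real^'n \<Rightarrow> real^'n^'n::finite" where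
  "christoffel c x p = (\<chi> i l. \<Sum>j\<in>UNIV. \<Sum>k\<in>UNIV. c x i j k l * p $ j * p $ k)"

definition lambda_qP :: "(real^'n \<Rightarrow> 'n tensor4) \<Rightarrow> real^'n \<Rightarrow> real^'n::finite \<Rightarrow> real" where
  "lambda_qP c x p = largest_eigenvalue (christoffel c x p)"

definition qP_globally_separate ::
    "(real^'n::finite) set \<Rightarrow> (real^'n \<Rightarrow> 'n tensor4) \<Rightarrow> bool" where
  "qP_globally_separate M c \<longleftrightarrow>
     (\<forall>x\<in>M. \<forall>p. p \<noteq> 0 \<longrightarrow> simple_eigenvalue (christoffel c x p) (lambda_qP c x p))"

definition legendre_qP ::
    "(real^'n \<Rightarrow> 'n tensor4) \<Rightarrow> (real^'n) \<times> (real^'n) \<Rightarrow> (real^'n) \<times> (real^'n::finite)" where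
  "legendre_qP c = (\<lambda>(x, p). (x, \<chi> i. partial_deriv (- {0}) i (\<lambda>q. lambda_qP c x q / 2) p))"

text \<open>
  For a positive definite stiffness tensor field with globally separate qP-branch the Legendre map
  is a bijection of \<open>M \<times> (- {0})\<close> onto itself, so \<^const>\<open>inv_into\<close> is its inverse.
\<close>

definition finsler_qP ::
    "(real^'n) set \<Rightarrow> (real^'n \<Rightarrow> 'n tensor4) \<Rightarrow> real^'n \<Rightarrow> real^'n::finite \<Rightarrow> real" where
  "finsler_qP M c x y =
     (if y = 0 then 0
      else case inv_into (M \<times> (- {0})) (legendre_qP c) (x, y) of (z, p) \<Rightarrow> sqrt (lambda_qP c z p))"

end

(*
The class mixed_C S U k m of functions f(x, u) possessing jointly continuous derivatives along every
word of at most m differentiations, at most k of them in x, is closed under ring operations,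
inverses, square roots and composition in the fibre. Two bootstrap arguments put the Finsler
function into it for every m.

Differentiating det (lambda I - Gamma) = 0 expresses the derivatives of a simple largest eigenvalue
rationally through lambda, Gamma and the derivatives of Gamma.

By Rayleigh's principle lambda(x, p) is the maximum over unit vectors a of the positive definite
quadratic forms p |-> sum c_ijkl(x) a_i p_j p_k a_l, hence strongly convex in p, locally uniformly
in x. Therefore the Legendre map is bijective on the punctured fibres with continuous inverse and
nondegenerate fibre derivative, and the implicit differentiation formula lets its inverse inherit
the regularity of lambda.
*)

theory Submission
  imports Defs
begin

section \<open>Mixed regularity\<close>

text \<open>The field is only C^k in x and M may contain boundary points, so the usual implicit
  function theorem is out of reach: derivatives in x are taken within M, which need not be open.
  Both bootstraps therefore start from a solution whose existence and continuity come from a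
  variational principle; the equation it satisfies yields only its differentiability. Rayleigh's
  principle makes the eigenvalue Lipschitz in the entries of a symmetric matrix; strong convexity
  makes the fibrewise inverse of the Legendre map Lipschitz, with a constant that survives small
  changes of x. The two counters are spent differently. A fibre derivative lowers m and leaves k
  alone, so the fibre gradient of lambda, and then the inverse Legendre map, keep all k derivatives
  in x; m is arbitrary and may be spent freely. At the end the coefficient functions must agree with
  the partial derivatives chosen in the definitions. At boundary points this rests on uniqueness of
  derivatives within M, and there the smoothness of the boundary enters.\<close>

definition linform :: "('n::finite \<Rightarrow> real) \<Rightarrow> real^'n \<Rightarrow> real" where
  "linform g h = (\<Sum>i\<in>UNIV. g i * h $ i)"

text \<open>The derivatives are coefficient functions asserted to exist, so that closure properties do not
  depend on the uniqueness of derivatives within \<open>S\<close>.\<close>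

fun mixed_C ::
    "(real^'m::finite) set \<Rightarrow> (real^'n::finite) set \<Rightarrow> nat \<Rightarrow> nat \<Rightarrow> (real^'m \<Rightarrow> real^'n \<Rightarrow> real) \<Rightarrow> bool" where
  "mixed_C S U k 0 f \<longleftrightarrow> continuous_on (S \<times> U) (\<lambda>(x, u). f x u)"
| "mixed_C S U k (Suc m) f \<longleftrightarrow> continuous_on (S \<times> U) (\<lambda>(x, u). f x u) \<and>
     (\<exists>g. (\<forall>i. mixed_C S U k m (g i)) \<and>
        (\<forall>x\<in>S. \<forall>u\<in>U. (f x has_derivative linform (\<lambda>i. g i x u)) (at u))) \<and>
     (0 < k \<longrightarrow> (\<exists>g. (\<forall>i. mixed_C S U (k - 1) m (g i)) \<and>
        (\<forall>x\<in>S. \<forall>u\<in>U. ((\<lambda>w. f w u) has_derivative linform (\<lambda>i. g i x u)) (at x within S))))"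

declare mixed_C.simps(2) [simp del]

lemma mixed_C_continuous: "mixed_C S U k m f \<Longrightarrow> continuous_on (S \<times> U) (\<lambda>(x, u). f x u)"
  by (cases m) (auto simp: mixed_C.simps(2))

lemma mixed_C_SucI:
  assumes "continuous_on (S \<times> U) (\<lambda>(x, u). f x u)"
    and "\<And>i. mixed_C S U k m (g i)"
    and "\<And>x u. x \<in> S \<Longrightarrow> u \<in> U \<Longrightarrow> (f x has_derivative linform (\<lambda>i. g i x u)) (at u)"
    and "\<And>i. 0 < k \<Longrightarrow> mixed_C S U (k - 1) m (h i)"
    and "\<And>x u. 0 < k \<Longrightarrow> x \<in> S \<Longrightarrow> u \<in> U \<Longrightarrow>
           ((\<lambda>w. f w u) has_derivative linform (\<lambda>i. h i x u)) (at x within S)"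
  shows "mixed_C S U k (Suc m) f"
  unfolding mixed_C.simps(2) using assms by blast

lemma mixed_C_sndE:
  assumes "mixed_C S U k (Suc m) f"
  obtains g where "\<And>i. mixed_C S U k m (g i)"
    "\<And>x u. x \<in> S \<Longrightarrow> u \<in> U \<Longrightarrow> (f x has_derivative linform (\<lambda>i. g i x u)) (at u)"
  using assms unfolding mixed_C.simps(2) by blast

lemma mixed_C_fstE:
  assumes "mixed_C S U k (Suc m) f"
  obtains g where "\<And>i. 0 < k \<Longrightarrow> mixed_C S U (k - 1) m (g i)"
    "\<And>x u. 0 < k \<Longrightarrow> x \<in> S \<Longrightarrow> u \<in> U \<Longrightarrow>
       ((\<lambda>w. f w u) has_derivative linform (\<lambda>i. g i x u)) (at x within S)"
  using assms unfolding mixed_C.simps(2) by (cases "0 < k") blast+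

lemma mixed_C_less_order: "mixed_C S U k (Suc m) f \<Longrightarrow> mixed_C S U k m f"
proof (induction m arbitrary: k f)
  case 0
  then show ?case by (simp add: mixed_C_continuous)
next
  case (Suc m)
  obtain g where g: "\<And>i. mixed_C S U k (Suc m) (g i)"
    "\<And>x u. x \<in> S \<Longrightarrow> u \<in> U \<Longrightarrow> (f x has_derivative linform (\<lambda>i. g i x u)) (at u)"
    using mixed_C_sndE[OF Suc.prems] by blast
  obtain h where h: "\<And>i. 0 < k \<Longrightarrow> mixed_C S U (k - 1) (Suc m) (h i)"
    "\<And>x u. 0 < k \<Longrightarrow> x \<in> S \<Longrightarrow> u \<in> U \<Longrightarrow>
       ((\<lambda>w. f w u) has_derivative linform (\<lambda>i. h i x u)) (at x within S)"
    using mixed_C_fstE[OF Suc.prems] by blast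
  show ?case
    by (rule mixed_C_SucI[where g = g and h = h])
      (use mixed_C_continuous[OF Suc.prems] Suc.IH g h in blast)+
qed

text \<open>A product rule in x pairs a derivative, at level \<open>k - 1\<close>, with
  undifferentiated factors at level \<open>k\<close>; this brings both to the same level. Truncated
  subtraction lets \<open>k = 0\<close> through as well.\<close>

lemma mixed_C_less_fst: "mixed_C S U k m f \<Longrightarrow> mixed_C S U (k - 1) m f"
proof (induction m arbitrary: k f)
  case 0
  then show ?case by simp
next
  case (Suc m)
  obtain g where g: "\<And>i. mixed_C S U k m (g i)"
    "\<And>x u. x \<in> S \<Longrightarrow> u \<in> U \<Longrightarrow> (f x has_derivative linform (\<lambda>i. g i x u)) (at u)"
    using mixed_C_sndE[OF Suc.prems] by blast
  obtain h where h: "\<And>i. 0 < k \<Longrightarrow> mixed_C S U (k - 1) m (h i)"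
    "\<And>x u. 0 < k \<Longrightarrow> x \<in> S \<Longrightarrow> u \<in> U \<Longrightarrow>
       ((\<lambda>w. f w u) has_derivative linform (\<lambda>i. h i x u)) (at x within S)"
    using mixed_C_fstE[OF Suc.prems] by blast
  have k: "0 < k - 1 \<Longrightarrow> 0 < k" by simp
  show ?case
    by (rule mixed_C_SucI[where g = g and h = h])
      (use mixed_C_continuous[OF Suc.prems] Suc.IH g h k in blast)+
qed

text \<open>Fibre derivatives are taken in the whole space, so openness of \<open>U\<close> is what
  makes them depend only on values over \<open>U\<close>; derivatives in x are taken within
  \<open>S\<close> anyway.\<close>

lemma mixed_C_cong:
  assumes "mixed_C S U k m f" "open U" "\<And>x u. x \<in> S \<Longrightarrow> u \<in> U \<Longrightarrow> f x u = f' x u"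
  shows "mixed_C S U k m f'"
proof (cases m)
  case 0
  then show ?thesis using assms by (auto cong: continuous_on_cong split: prod.splits
      elim!: continuous_on_eq)
next
  case (Suc m')
  have c: "continuous_on (S \<times> U) (\<lambda>(x, u). f' x u)"
    using mixed_C_continuous[OF assms(1)] by (rule continuous_on_eq) (use assms(3) in auto)
  obtain g where g: "\<And>i. mixed_C S U k m' (g i)"
    "\<And>x u. x \<in> S \<Longrightarrow> u \<in> U \<Longrightarrow> (f x has_derivative linform (\<lambda>i. g i x u)) (at u)"
    using mixed_C_sndE assms(1) unfolding Suc by metis
  obtain h where h: "\<And>i. 0 < k \<Longrightarrow> mixed_C S U (k - 1) m' (h i)"
    "\<And>x u. 0 < k \<Longrightarrow> x \<in> S \<Longrightarrow> u \<in> U \<Longrightarrow>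
       ((\<lambda>w. f w u) has_derivative linform (\<lambda>i. h i x u)) (at x within S)"
    using mixed_C_fstE assms(1) unfolding Suc by metis
  show ?thesis unfolding Suc
  proof (rule mixed_C_SucI[where g = g and h = h, OF c g(1) _ h(1)])
    fix x u assume xu: "x \<in> S" "u \<in> U"
    show "(f' x has_derivative linform (\<lambda>i. g i x u)) (at u)"
      using has_derivative_transform_within_open[OF g(2)[OF xu] assms(2) xu(2)] assms(3) xu by blast
    assume "0 < k"
    from h(2)[OF this xu] show "((\<lambda>w. f' w u) has_derivative linform (\<lambda>i. h i x u)) (at x within S)"
      by (rule has_derivative_transform[rotated 2]) (use xu assms(3) in auto)
  qed
qed

section \<open>Derivatives as linear forms, and closure under algebraic operations\<close>

lemma linform_zero: "linform (\<lambda>i. 0) = (\<lambda>h. 0)"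
  by (simp add: linform_def fun_eq_iff)

lemma linform_add: "(\<lambda>h. linform a h + linform b h) = linform (\<lambda>i. a i + b i)"
  by (simp add: linform_def fun_eq_iff sum.distrib distrib_right)

lemma linform_cmult: "(\<lambda>h. r * linform a h) = linform (\<lambda>i. r * a i)"
  by (simp add: linform_def fun_eq_iff sum_distrib_left mult.assoc)

lemma linform_sum: "(\<lambda>h. \<Sum>j\<in>J. linform (a j) h) = linform (\<lambda>i. \<Sum>j\<in>J. a j i)"
  unfolding linform_def fun_eq_iff by (auto simp: sum_distrib_right intro: sum.swap)

lemma linform_axis: "linform a (axis i 1) = a i"
  by (simp add: linform_def axis_def if_distrib cong: if_cong)

lemma linform_linear: "linear D \<Longrightarrow> D = linform (\<lambda>i. D (axis i 1))"
  for D :: "real^'n::finite \<Rightarrow> real"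
proof
  fix h :: "real^'n" assume D: "linear D"
  have "D h = D (\<Sum>i\<in>UNIV. h $ i *\<^sub>R axis i 1)"
    by (simp add: basis_expansion[of h, unfolded scalar_mult_eq_scaleR])
  also have "\<dots> = linform (\<lambda>i. D (axis i 1)) h"
    using D by (simp add: linear_sum linear_cmul linform_def mult.commute)
  finally show "D h = linform (\<lambda>i. D (axis i 1)) h" .
qed

lemma bounded_linear_linform [intro, simp]: "bounded_linear (linform a)"
  unfolding linform_def
  by (intro bounded_linear_sum bounded_linear_const_mult bounded_linear_vec_nth)

lemma mixed_C_const: "mixed_C S U k m (\<lambda>x u. r)"
proof (induction m arbitrary: k r)
  case (Suc m)
  show ?case
    by (rule mixed_C_SucI[where g = "\<lambda>i x u. 0" and h = "\<lambda>i x u. 0"])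
      (simp_all add: Suc linform_zero)
qed simp

lemma mixed_C_fibre_coord: "mixed_C S U k m (\<lambda>x u. u $ j)"
proof (cases m)
  case 0
  then show ?thesis by (auto simp: case_prod_beta intro!: continuous_intros)
next
  case (Suc m)
  have *: "linform (\<lambda>i. if i = j then 1 else 0) = (\<lambda>h. h $ j)"
    by (simp add: linform_def fun_eq_iff if_distribR if_distrib[where f = "\<lambda>a. a * b" for b] cong: if_cong)
  show ?thesis unfolding Suc
  proof (rule mixed_C_SucI[where g = "\<lambda>i x u. if i = j then 1 else 0" and h = "\<lambda>i x u. 0"])
    show "continuous_on (S \<times> U) (\<lambda>(x, u). u $ j)"
      by (auto simp: case_prod_beta intro!: continuous_intros)
  qed (auto simp: linform_zero * intro!: mixed_C_const bounded_linear.has_derivative[OF bounded_linear_vec_nth] derivative_eq_intros)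
qed

lemma mixed_C_add:
  "mixed_C S U k m f \<Longrightarrow> mixed_C S U k m g \<Longrightarrow> mixed_C S U k m (\<lambda>x u. f x u + g x u)"
proof (induction m arbitrary: k f g)
  case 0
  then show ?case by (auto simp: case_prod_beta intro!: continuous_intros)
next
  case (Suc m)
  obtain f1 where f1: "\<And>i. mixed_C S U k m (f1 i)"
    "\<And>x u. x \<in> S \<Longrightarrow> u \<in> U \<Longrightarrow> (f x has_derivative linform (\<lambda>i. f1 i x u)) (at u)"
    using mixed_C_sndE[OF Suc.prems(1)] by blast
  obtain f2 where f2: "\<And>i. 0 < k \<Longrightarrow> mixed_C S U (k - 1) m (f2 i)"
    "\<And>x u. 0 < k \<Longrightarrow> x \<in> S \<Longrightarrow> u \<in> U \<Longrightarrow>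
       ((\<lambda>w. f w u) has_derivative linform (\<lambda>i. f2 i x u)) (at x within S)"
    using mixed_C_fstE[OF Suc.prems(1)] by blast
  obtain g1 where g1: "\<And>i. mixed_C S U k m (g1 i)"
    "\<And>x u. x \<in> S \<Longrightarrow> u \<in> U \<Longrightarrow> (g x has_derivative linform (\<lambda>i. g1 i x u)) (at u)"
    using mixed_C_sndE[OF Suc.prems(2)] by blast
  obtain g2 where g2: "\<And>i. 0 < k \<Longrightarrow> mixed_C S U (k - 1) m (g2 i)"
    "\<And>x u. 0 < k \<Longrightarrow> x \<in> S \<Longrightarrow> u \<in> U \<Longrightarrow>
       ((\<lambda>w. g w u) has_derivative linform (\<lambda>i. g2 i x u)) (at x within S)"
    using mixed_C_fstE[OF Suc.prems(2)] by blast
  show ?case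
  proof (rule mixed_C_SucI[where g = "\<lambda>i x u. f1 i x u + g1 i x u" and h = "\<lambda>i x u. f2 i x u + g2 i x u"])
    show "continuous_on (S \<times> U) (\<lambda>(x, u). f x u + g x u)"
      using Suc.prems[THEN mixed_C_continuous]
      by (auto simp: case_prod_beta intro!: continuous_intros)
  qed (use Suc.IH f1 f2 g1 g2 in \<open>auto simp flip: linform_add intro!: has_derivative_add\<close>)
qed

lemma mixed_C_mult:
  "mixed_C S U k m f \<Longrightarrow> mixed_C S U k m g \<Longrightarrow> mixed_C S U k m (\<lambda>x u. f x u * g x u)"
proof (induction m arbitrary: k f g)
  case 0
  then show ?case by (auto simp: case_prod_beta intro!: continuous_intros)
next
  case (Suc m)
  obtain f1 where f1: "\<And>i. mixed_C S U k m (f1 i)"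
    "\<And>x u. x \<in> S \<Longrightarrow> u \<in> U \<Longrightarrow> (f x has_derivative linform (\<lambda>i. f1 i x u)) (at u)"
    using mixed_C_sndE[OF Suc.prems(1)] by blast
  obtain f2 where f2: "\<And>i. 0 < k \<Longrightarrow> mixed_C S U (k - 1) m (f2 i)"
    "\<And>x u. 0 < k \<Longrightarrow> x \<in> S \<Longrightarrow> u \<in> U \<Longrightarrow>
       ((\<lambda>w. f w u) has_derivative linform (\<lambda>i. f2 i x u)) (at x within S)"
    using mixed_C_fstE[OF Suc.prems(1)] by blast
  obtain g1 where g1: "\<And>i. mixed_C S U k m (g1 i)"
    "\<And>x u. x \<in> S \<Longrightarrow> u \<in> U \<Longrightarrow> (g x has_derivative linform (\<lambda>i. g1 i x u)) (at u)"
    using mixed_C_sndE[OF Suc.prems(2)] by blast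
  obtain g2 where g2: "\<And>i. 0 < k \<Longrightarrow> mixed_C S U (k - 1) m (g2 i)"
    "\<And>x u. 0 < k \<Longrightarrow> x \<in> S \<Longrightarrow> u \<in> U \<Longrightarrow>
       ((\<lambda>w. g w u) has_derivative linform (\<lambda>i. g2 i x u)) (at x within S)"
    using mixed_C_fstE[OF Suc.prems(2)] by blast
  \<comment> \<open>One factor in each term of the product rule stays undifferentiated; it must give
    up one order to fit the induction hypothesis.\<close>
  note low = Suc.prems[THEN mixed_C_less_order]
  have lin: "linform (\<lambda>i. r * b i + s * a i) = (\<lambda>h. r * linform b h + linform a h * s)"
    for r s :: real and a b :: "'j::finite \<Rightarrow> real"
    by (simp add: linform_def fun_eq_iff sum.distrib sum_distrib_left algebra_simps)
  show ?case
  proof (rule mixed_C_SucI[where g = "\<lambda>i x u. f x u * g1 i x u + g x u * f1 i x u"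
        and h = "\<lambda>i x u. f x u * g2 i x u + g x u * f2 i x u"])
    show "continuous_on (S \<times> U) (\<lambda>(x, u). f x u * g x u)"
      using Suc.prems[THEN mixed_C_continuous]
      by (auto simp: case_prod_beta intro!: continuous_intros)
    show "mixed_C S U k m (\<lambda>x u. f x u * g1 i x u + g x u * f1 i x u)" for i
      by (intro mixed_C_add Suc.IH low f1 g1)
    show "mixed_C S U (k - 1) m (\<lambda>x u. f x u * g2 i x u + g x u * f2 i x u)" if "0 < k" for i
      by (intro mixed_C_add Suc.IH low[THEN mixed_C_less_fst] f2 g2 that)
  qed (unfold lin, (intro has_derivative_mult f1 f2 g1 g2; assumption)+)
qed

lemma mixed_C_sum:
  "(\<And>j. j \<in> J \<Longrightarrow> mixed_C S U k m (f j)) \<Longrightarrow> mixed_C S U k m (\<lambda>x u. \<Sum>j\<in>J. f j x u)"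
  by (induction J rule: infinite_finite_induct) (auto intro: mixed_C_const mixed_C_add)

lemma mixed_C_prod:
  "(\<And>j. j \<in> J \<Longrightarrow> mixed_C S U k m (f j)) \<Longrightarrow> mixed_C S U k m (\<lambda>x u. \<Prod>j\<in>J. f j x u)"
  by (induction J rule: infinite_finite_induct) (auto intro: mixed_C_const mixed_C_mult)

text \<open>A small bootstrap: the derivative of \<open>1 / f\<close> contains \<open>1 / f\<close>
  itself, but only one order lower. The sign is written as a factor \<open>-1\<close> so that
  \<open>mixed_C_mult\<close> and \<open>mixed_C_const\<close> cover it.\<close>

lemma mixed_C_inverse:
  assumes "mixed_C S U k m f" "\<And>x u. x \<in> S \<Longrightarrow> u \<in> U \<Longrightarrow> f x u \<noteq> 0"
  shows "mixed_C S U k m (\<lambda>x u. inverse (f x u))"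
  using assms(1)
proof (induction m arbitrary: k)
  case 0
  then show ?case using assms(2) by (auto simp: case_prod_beta intro!: continuous_intros)
next
  case (Suc m)
  obtain f1 where f1: "\<And>i. mixed_C S U k m (f1 i)"
    "\<And>x u. x \<in> S \<Longrightarrow> u \<in> U \<Longrightarrow> (f x has_derivative linform (\<lambda>i. f1 i x u)) (at u)"
    using mixed_C_sndE[OF Suc.prems(1)] by blast
  obtain f2 where f2: "\<And>i. 0 < k \<Longrightarrow> mixed_C S U (k - 1) m (f2 i)"
    "\<And>x u. 0 < k \<Longrightarrow> x \<in> S \<Longrightarrow> u \<in> U \<Longrightarrow>
       ((\<lambda>w. f w u) has_derivative linform (\<lambda>i. f2 i x u)) (at x within S)"
    using mixed_C_fstE[OF Suc.prems(1)] by blast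
  have low: "mixed_C S U k m (\<lambda>x u. inverse (f x u))"
    using Suc.IH[OF mixed_C_less_order[OF Suc.prems]] .
  have lin: "linform (\<lambda>i. -1 * (r * (a i * r))) = (\<lambda>h. - (r * linform a h * r))"
    for r :: real and a :: "'j::finite \<Rightarrow> real"
    by (simp add: linform_def fun_eq_iff sum_distrib_left sum_distrib_right sum_negf algebra_simps)
  show ?case
  proof (rule mixed_C_SucI[where g = "\<lambda>i x u. -1 * (inverse (f x u) * (f1 i x u * inverse (f x u)))"
        and h = "\<lambda>i x u. -1 * (inverse (f x u) * (f2 i x u * inverse (f x u)))"])
    show "continuous_on (S \<times> U) (\<lambda>(x, u). inverse (f x u))"
      using Suc.prems[THEN mixed_C_continuous] assms(2)
      by (auto simp: case_prod_beta intro!: continuous_intros)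
    show "mixed_C S U k m (\<lambda>x u. -1 * (inverse (f x u) * (f1 i x u * inverse (f x u))))" for i
      by (intro mixed_C_mult mixed_C_const low f1)
    show "mixed_C S U (k - 1) m (\<lambda>x u. -1 * (inverse (f x u) * (f2 i x u * inverse (f x u))))" if "0 < k" for i
      by (intro mixed_C_mult mixed_C_const low[THEN mixed_C_less_fst] f2 that)
    show "((\<lambda>u. inverse (f x u)) has_derivative
        linform (\<lambda>i. -1 * (inverse (f x u) * (f1 i x u * inverse (f x u))))) (at u)"
      if "x \<in> S" "u \<in> U" for x u
      using Deriv.has_derivative_inverse[OF assms(2) f1(2)] that unfolding lin by blast
    show "((\<lambda>w. inverse (f w u)) has_derivative
        linform (\<lambda>i. -1 * (inverse (f x u) * (f2 i x u * inverse (f x u))))) (at x within S)"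
      if "0 < k" "x \<in> S" "u \<in> U" for x u
      using Deriv.has_derivative_inverse[OF assms(2) f2(2)] that unfolding lin by blast
  qed
qed

text \<open>The same bootstrap; positivity keeps \<open>f\<close> away from the point where the root
  is not differentiable.\<close>

lemma mixed_C_sqrt:
  assumes "mixed_C S U k m f" "\<And>x u. x \<in> S \<Longrightarrow> u \<in> U \<Longrightarrow> f x u > 0"
  shows "mixed_C S U k m (\<lambda>x u. sqrt (f x u))"
  using assms(1)
proof (induction m arbitrary: k)
  case 0
  then show ?case by (auto simp: case_prod_beta intro!: continuous_intros)
next
  case (Suc m)
  obtain f1 where f1: "\<And>i. mixed_C S U k m (f1 i)"
    "\<And>x u. x \<in> S \<Longrightarrow> u \<in> U \<Longrightarrow> (f x has_derivative linform (\<lambda>i. f1 i x u)) (at u)"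
    using mixed_C_sndE[OF Suc.prems(1)] by blast
  obtain f2 where f2: "\<And>i. 0 < k \<Longrightarrow> mixed_C S U (k - 1) m (f2 i)"
    "\<And>x u. 0 < k \<Longrightarrow> x \<in> S \<Longrightarrow> u \<in> U \<Longrightarrow>
       ((\<lambda>w. f w u) has_derivative linform (\<lambda>i. f2 i x u)) (at x within S)"
    using mixed_C_fstE[OF Suc.prems(1)] by blast
  have low: "mixed_C S U k m (\<lambda>x u. inverse (sqrt (f x u)))"
    using Suc.IH[OF mixed_C_less_order[OF Suc.prems]]
    by (rule mixed_C_inverse) (use assms(2) in force)
  have lin: "linform (\<lambda>i. r * (a i * (1/2))) = (\<lambda>h. linform a h * (r / 2))"
    for r :: real and a :: "'j::finite \<Rightarrow> real"
    by (simp add: linform_def fun_eq_iff sum_distrib_left sum_distrib_right algebra_simps)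
  show ?case
  proof (rule mixed_C_SucI[where g = "\<lambda>i x u. inverse (sqrt (f x u)) * (f1 i x u * (1/2))"
        and h = "\<lambda>i x u. inverse (sqrt (f x u)) * (f2 i x u * (1/2))"])
    show "continuous_on (S \<times> U) (\<lambda>(x, u). sqrt (f x u))"
      using Suc.prems[THEN mixed_C_continuous]
      by (auto simp: case_prod_beta intro!: continuous_intros)
    show "mixed_C S U k m (\<lambda>x u. inverse (sqrt (f x u)) * (f1 i x u * (1/2)))" for i
      by (intro mixed_C_mult mixed_C_const low f1)
    show "mixed_C S U (k - 1) m (\<lambda>x u. inverse (sqrt (f x u)) * (f2 i x u * (1/2)))" if "0 < k" for i
      by (intro mixed_C_mult mixed_C_const low[THEN mixed_C_less_fst] f2 that)
  qed (unfold lin, (intro has_derivative_real_sqrt f1 f2 assms; assumption)+)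
qed

lemma mixed_C_det:
  assumes "\<And>i j. mixed_C S U k m (\<lambda>x u. N x u $ i $ j)"
  shows "mixed_C S U k m (\<lambda>x u. det (N x u :: real^'d^'d::finite))"
  unfolding det_def
  by (intro mixed_C_sum mixed_C_mult mixed_C_prod mixed_C_const assms)

section \<open>Composition and implicit functions\<close>

text \<open>The component type is itself a Euclidean space, so two applications reduce a
  matrix-valued map to its entries.\<close>

lemma has_derivative_vecI:
  fixes f :: "'a::real_normed_vector \<Rightarrow> 'b::euclidean_space^'n::finite"
  assumes "\<And>i. ((\<lambda>x. f x $ i) has_derivative (\<lambda>h. D h $ i)) (at a within S)"
  shows "(f has_derivative D) (at a within S)"
  using assms by (subst has_derivative_componentwise_within) (auto simp: Basis_vec_def inner_axis intro: has_derivative_inner_left)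

lemma has_derivative_vec_nth:
  "(f has_derivative D) F \<Longrightarrow> ((\<lambda>x. f x $ i) has_derivative (\<lambda>h. D h $ i)) F"
  by (rule bounded_linear.has_derivative[OF bounded_linear_vec_nth])

text \<open>Constancy of \<open>G\<close> along the graph gives
  \<open>A h + B v = o(|h| + |v|)\<close> for the increments \<open>h\<close> of the argument and
  \<open>v\<close> of \<open>\<phi>\<close>. The left inverse \<open>B'\<close> turns this into
  \<open>v + B' (A h) = o(|h| + |v|)\<close>, and the share of \<open>v\<close> is absorbed on the
  left. As \<open>\<phi>\<close> is given and continuous, \<open>X\<close> may be any set.\<close>

lemma has_derivative_implicit:
  fixes G :: "'a::real_normed_vector \<times> 'b::real_normed_vector \<Rightarrow> 'c::real_normed_vector"
  assumes G: "(G has_derivative (\<lambda>(h, v). A h + B v)) (at (z, \<phi> z) within X \<times> Y)"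
    and cont: "continuous (at z within X) \<phi>"
    and X: "z \<in> X" "\<And>w. w \<in> X \<Longrightarrow> \<phi> w \<in> Y" "\<And>w. w \<in> X \<Longrightarrow> G (w, \<phi> w) = G (z, \<phi> z)"
    and A: "bounded_linear A"
    and B: "bounded_linear B'" "\<And>v. B' (B v) = v"
  shows "(\<phi> has_derivative (\<lambda>h. - B' (A h))) (at z within X)"
  unfolding has_derivative_within_alt
proof (intro conjI allI impI)
  interpret B': bounded_linear B' by fact
  have BA: "bounded_linear (\<lambda>h. B' (A h))"
    using bounded_linear_compose[OF B(1) A] .
  then show "bounded_linear (\<lambda>h. - B' (A h))" by (rule bounded_linear_minus)
  obtain K where K: "K > 0" "\<And>w. norm (B' w) \<le> norm w * K"
    using B'.pos_bounded by blast
  obtain L where L: "L > 0" "\<And>h. norm (B' (A h)) \<le> norm h * L"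
    using bounded_linear.pos_bounded[OF BA] by blast
  fix e :: real assume e: "e > 0"
  \<comment> \<open>The first bound makes \<open>K * e1\<close> at most 1/2, enough to absorb the
    increment of \<open>\<phi>\<close>; the second turns the resulting
    \<open>a + b \<le> (2 * L + 2) * a\<close> into an error of at most
    \<open>e * a\<close>.\<close>
  define e1 where "e1 = min (1 / (2 * K)) (e / (K * (2 * L + 2)))"
  have e1: "e1 > 0" "K * e1 \<le> 1 / 2" "K * e1 * (2 * L + 2) \<le> e"
  proof -
    show "e1 > 0" using K L e by (simp add: e1_def)
    have "K * e1 \<le> K * (1 / (2 * K))" using K by (intro mult_left_mono) (auto simp: e1_def)
    then show "K * e1 \<le> 1 / 2" using K by simp
    have "K * e1 * (2 * L + 2) \<le> K * (e / (K * (2 * L + 2))) * (2 * L + 2)"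
      using K L by (intro mult_right_mono mult_left_mono) (auto simp: e1_def)
    also have "\<dots> = e" using K(1) L(1) by (smt (verit) mult_pos_pos nonzero_eq_divide_eq mult.assoc mult.commute)
    finally show "K * e1 * (2 * L + 2) \<le> e" .
  qed
  obtain d1 where d1: "d1 > 0" "\<And>y. y \<in> X \<times> Y \<Longrightarrow> norm (y - (z, \<phi> z)) < d1 \<Longrightarrow>
      norm (G y - G (z, \<phi> z) - (case y - (z, \<phi> z) of (h, v) \<Rightarrow> A h + B v)) \<le> e1 * norm (y - (z, \<phi> z))"
    using G e1(1) unfolding has_derivative_within_alt by blast
  obtain d2 where d2: "d2 > 0" "\<And>y. y \<in> X \<Longrightarrow> dist y z < d2 \<Longrightarrow> dist (\<phi> y) (\<phi> z) < d1 / 2"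
    using cont d1(1) unfolding continuous_within_eps_delta by (meson half_gt_zero)
  show "\<exists>d>0. \<forall>y\<in>X. norm (y - z) < d \<longrightarrow>
      norm (\<phi> y - \<phi> z - - B' (A (y - z))) \<le> e * norm (y - z)"
  proof (intro exI[of _ "min (d1 / 2) d2"] conjI ballI impI)
    show "0 < min (d1 / 2) d2" using d1 d2 by simp
    fix y assume y: "y \<in> X" "norm (y - z) < min (d1 / 2) d2"
    define a b where "a = norm (y - z)" and "b = norm (\<phi> y - \<phi> z)"
    have ab: "norm ((y, \<phi> y) - (z, \<phi> z)) \<le> a + b"
      using norm_Pair_le[of "y - z" "\<phi> y - \<phi> z"] by (simp add: a_def b_def)
    have "b < d1 / 2" using d2(2)[of y] y by (auto simp: b_def dist_norm)
    then have "norm ((y, \<phi> y) - (z, \<phi> z)) < d1" using ab y by (auto simp: a_def)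
    from d1(2)[OF _ this] have "norm (A (y - z) + B (\<phi> y - \<phi> z)) \<le> e1 * norm ((y, \<phi> y) - (z, \<phi> z))"
      using X(2,3) y by (simp add: norm_minus_commute flip: norm_minus_cancel[of "A _ + B _"])
    then have E: "norm (A (y - z) + B (\<phi> y - \<phi> z)) \<le> e1 * (a + b)"
      using ab e1(1) by (meson mult_left_mono order_trans less_imp_le)
    have "norm (\<phi> y - \<phi> z + B' (A (y - z))) = norm (B' (A (y - z) + B (\<phi> y - \<phi> z)))"
      by (simp add: B'.add B(2) add.commute)
    also have "\<dots> \<le> e1 * (a + b) * K"
      using K(2) E K(1) by (meson mult_right_mono order_trans less_imp_le)
    finally have F: "norm (\<phi> y - \<phi> z + B' (A (y - z))) \<le> K * e1 * (a + b)" by (simp add: mult_ac)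
    \<comment> \<open>Here the absorption takes place: half of \<open>b\<close> reappears on the
      right and is moved to the left, so \<open>b\<close> is bounded by a multiple of
      \<open>a\<close>.\<close>
    have "b \<le> norm (\<phi> y - \<phi> z + B' (A (y - z))) + norm (B' (A (y - z)))"
      unfolding b_def using norm_triangle_ineq4[of "\<phi> y - \<phi> z + B' (A (y - z))" "B' (A (y - z))"] by simp
    also have "\<dots> \<le> K * e1 * (a + b) + a * L" using F L(2)[of "y - z"] by (simp add: a_def)
    also have "\<dots> \<le> 1 / 2 * (a + b) + a * L"
      using e1(2) by (intro add_right_mono mult_right_mono) (auto simp: a_def b_def)
    finally have "b \<le> (2 * L + 1) * a" using mult.commute[of a L] by (simp add: distrib_right distrib_left)
    then have "K * e1 * (a + b) \<le> K * e1 * ((2 * L + 2) * a)"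
      using K e1 by (intro mult_left_mono) (auto simp: algebra_simps)
    also have "\<dots> \<le> e * a"
      using mult_right_mono[OF e1(3), of a] by (simp add: a_def mult_ac)
    finally show "norm (\<phi> y - \<phi> z - - B' (A (y - z))) \<le> e * norm (y - z)"
      using F by (simp add: a_def)
  qed
qed

text \<open>The increment is split into a fibre step over the displaced base point, controlled by
  the joint continuity of the fibre derivative, and a base step with \<open>u\<close> fixed. In x,
  differentiability at the single point \<open>x\<close> is therefore enough.\<close>

lemma has_derivative_joint:
  fixes f :: "real^'m::finite \<Rightarrow> real^'n::finite \<Rightarrow> real"
  assumes "open U" "x \<in> S" "u \<in> U"
    and g: "\<And>x u. x \<in> S \<Longrightarrow> u \<in> U \<Longrightarrow> (f x has_derivative linform (\<lambda>i. g i x u)) (at u)"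
    and g_cont: "\<And>i. continuous_on (S \<times> U) (\<lambda>(x, u). g i x u)"
    and D: "((\<lambda>w. f w u) has_derivative D) (at x within S)"
  shows "((\<lambda>(x, u). f x u) has_derivative (\<lambda>(h, v). D h + linform (\<lambda>i. g i x u) v))
           (at (x, u) within S \<times> U)"
proof -
  \<comment> \<open>The criterion for partial derivatives wants a convex fibre set, which the
    punctured space is not; it is applied on a ball, and the filter is changed back to
    \<open>U\<close> afterwards.\<close>
  obtain r where r: "r > 0" "ball u r \<subseteq> U" using assms(1,3) open_contains_ball by blast
  define G where "G x u = (\<Sum>i\<in>UNIV. g i x u *\<^sub>R Blinfun (\<lambda>h::real^'n. h $ i))" for x u
  have G: "blinfun_apply (G x u) = linform (\<lambda>i. g i x u)" for x u
    by (simp add: G_def linform_def fun_eq_iff blinfun.sum_left blinfun.scaleR_left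
        bounded_linear_Blinfun_apply[OF bounded_linear_vec_nth])
  have "continuous_on (S \<times> U) (\<lambda>(x, u). G x u)"
    unfolding G_def case_prod_beta
    by (intro continuous_intros) (use g_cont in \<open>auto simp: case_prod_beta\<close>)
  then have "continuous_on (S \<times> ball u r) (\<lambda>(x, u). G x u)"
    by (rule continuous_on_subset) (use r in auto)
  then have c: "continuous (at (x, u) within S \<times> ball u r) (\<lambda>(x, u). G x u)"
    using assms(2) r(1) by (simp add: continuous_on_eq_continuous_within)
  have "((\<lambda>(x, u). f x u) has_derivative (\<lambda>(h, v). D h + blinfun_apply (G x u) v))
           (at (x, u) within S \<times> ball u r)"
  proof (rule has_derivative_partialsI[where f = f and fy = G and y = u and Y = "ball u r", OF D _ c])
    show "(f x' has_derivative blinfun_apply (G x' u')) (at u' within ball u r)"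
      if "x' \<in> S" "u' \<in> ball u r" for x' u'
      unfolding G by (rule has_derivative_at_withinI, rule g) (use that r in auto)
  qed (use r in auto)
  moreover have "at (x, u) within S \<times> ball u r = at (x, u) within S \<times> U"
    by (rule at_within_nhd[of _ "UNIV \<times> ball u r"]) (use r in \<open>auto intro: open_Times\<close>)
  ultimately show ?thesis by (simp add: G)
qed

section \<open>Composition in the fibre and fibrewise inverses\<close>

lemma mixed_C_vec_continuous:
  assumes "\<And>j. mixed_C S U k m (\<lambda>x u. P x u $ j)"
  shows "continuous_on (S \<times> U) (\<lambda>(x, u). P x u)"
proof -
  have "continuous_on (S \<times> U) (\<lambda>z. \<chi> j. P (fst z) (snd z) $ j)"
    by (intro continuous_on_vec_lambda)
      (use assms[THEN mixed_C_continuous] in \<open>auto simp: case_prod_beta\<close>)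
  then show ?thesis by (simp add: case_prod_beta)
qed

text \<open>The base point enters both through \<open>f x\<close> and through \<open>P x u\<close>,
  so the x-derivative comes from the chain rule along \<open>w \<mapsto> (w, P w u)\<close> and the
  joint derivative of \<open>f\<close>. The fibre partials of \<open>f\<close> that it contains are
  still at level \<open>k\<close>, so no derivative in x is lost.\<close>

lemma mixed_C_compose:
  fixes f :: "real^'m::finite \<Rightarrow> real^'n::finite \<Rightarrow> real"
  assumes "open U"
    and PU: "\<And>x u. x \<in> S \<Longrightarrow> u \<in> U \<Longrightarrow> P x u \<in> U"
  shows "mixed_C S U k m f \<Longrightarrow> (\<And>j. mixed_C S U k m (\<lambda>x u. P x u $ j)) \<Longrightarrow>
    mixed_C S U k m (\<lambda>x u. f x (P x u))"
proof (induction m arbitrary: k f)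
  have cont: "continuous_on (S \<times> U) (\<lambda>(x, u). f x (P x u))"
    if "mixed_C S U k m f" "\<And>j. mixed_C S U k m (\<lambda>x u. P x u $ j)" for k m f
  proof -
    have "continuous_on (S \<times> U) ((\<lambda>(x, u). f x u) \<circ> (\<lambda>z. (fst z, (\<lambda>(x, u). P x u) z)))"
      by (intro continuous_on_compose continuous_on_Pair continuous_on_fst continuous_on_id
          mixed_C_vec_continuous[OF that(2)] continuous_on_subset[OF mixed_C_continuous[OF that(1)]])
        (use PU in auto)
    then show ?thesis by (simp add: case_prod_beta o_def)
  qed
  {
    case 0
    show ?case using cont[OF 0] by simp
  next
    case (Suc m)
    note low = mixed_C_less_order[OF Suc.prems(2)]
    obtain f1 where f1: "\<And>i. mixed_C S U k m (f1 i)"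
      "\<And>x u. x \<in> S \<Longrightarrow> u \<in> U \<Longrightarrow> (f x has_derivative linform (\<lambda>i. f1 i x u)) (at u)"
      using mixed_C_sndE[OF Suc.prems(1)] by blast
    obtain f2 where f2: "\<And>i. 0 < k \<Longrightarrow> mixed_C S U (k - 1) m (f2 i)"
      "\<And>x u. 0 < k \<Longrightarrow> x \<in> S \<Longrightarrow> u \<in> U \<Longrightarrow>
         ((\<lambda>w. f w u) has_derivative linform (\<lambda>i. f2 i x u)) (at x within S)"
      using mixed_C_fstE[OF Suc.prems(1)] by blast
    have "\<exists>g. (\<forall>i. mixed_C S U k m (g i)) \<and> (\<forall>x\<in>S. \<forall>u\<in>U.
        ((\<lambda>u. P x u $ j) has_derivative linform (\<lambda>i. g i x u)) (at u))" for j
      using mixed_C_sndE[OF Suc.prems(2)[of j]] by metis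
    then obtain P1 where P1: "\<And>j i. mixed_C S U k m (P1 j i)"
      "\<And>j x u. x \<in> S \<Longrightarrow> u \<in> U \<Longrightarrow>
         ((\<lambda>u. P x u $ j) has_derivative linform (\<lambda>i. P1 j i x u)) (at u)"
      by metis
    have "\<exists>g. (\<forall>i. 0 < k \<longrightarrow> mixed_C S U (k - 1) m (g i)) \<and> (\<forall>x\<in>S. \<forall>u\<in>U. 0 < k \<longrightarrow>
        ((\<lambda>w. P w u $ j) has_derivative linform (\<lambda>i. g i x u)) (at x within S))" for j
      using mixed_C_fstE[OF Suc.prems(2)[of j]] by metis
    then obtain P2 where P2: "\<And>j i. 0 < k \<Longrightarrow> mixed_C S U (k - 1) m (P2 j i)"
      "\<And>j x u. 0 < k \<Longrightarrow> x \<in> S \<Longrightarrow> u \<in> U \<Longrightarrow>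
         ((\<lambda>w. P w u $ j) has_derivative linform (\<lambda>i. P2 j i x u)) (at x within S)"
      by metis
    have lin: "linform a (\<chi> j. linform (b j) h) = linform (\<lambda>i. \<Sum>j\<in>UNIV. a j * b j i) h"
      for a :: "'n \<Rightarrow> real" and b :: "'n \<Rightarrow> 'j::finite \<Rightarrow> real" and h
      unfolding linform_def vec_lambda_beta sum_distrib_left sum_distrib_right mult.assoc
      by (rule sum.swap)
    have f1P: "mixed_C S U k m (\<lambda>x u. f1 j x (P x u))" for j
      by (rule Suc.IH[OF f1(1) low])
    have f2P: "mixed_C S U (k - 1) m (\<lambda>x u. f2 j x (P x u))" if "0 < k" for j
      by (rule Suc.IH[OF f2(1)[OF that] low[THEN mixed_C_less_fst]])
    show ?case
    proof (rule mixed_C_SucI[where g = "\<lambda>i x u. \<Sum>j\<in>UNIV. f1 j x (P x u) * P1 j i x u"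
          and h = "\<lambda>i x u. f2 i x (P x u) + (\<Sum>j\<in>UNIV. f1 j x (P x u) * P2 j i x u)"])
      show "continuous_on (S \<times> U) (\<lambda>(x, u). f x (P x u))"
        by (rule cont[OF Suc.prems])
      show "mixed_C S U k m (\<lambda>x u. \<Sum>j\<in>UNIV. f1 j x (P x u) * P1 j i x u)" for i
        by (intro mixed_C_sum mixed_C_mult f1P P1)
      show "mixed_C S U (k - 1) m (\<lambda>x u. f2 i x (P x u) + (\<Sum>j\<in>UNIV. f1 j x (P x u) * P2 j i x u))"
        if "0 < k" for i
        by (intro mixed_C_add mixed_C_sum mixed_C_mult f2P P2 that f1P[THEN mixed_C_less_fst])
    next
      fix x u assume xu: "x \<in> S" "u \<in> U"
      have "(P x has_derivative (\<lambda>h. \<chi> j. linform (\<lambda>i. P1 j i x u) h)) (at u)"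
        by (rule has_derivative_vecI) (simp add: P1 xu)
      from has_derivative_compose[OF this f1(2)[OF xu(1) PU[OF xu]]]
      show "((\<lambda>u. f x (P x u)) has_derivative
          linform (\<lambda>i. \<Sum>j\<in>UNIV. f1 j x (P x u) * P1 j i x u)) (at u)"
        by (simp add: lin)
      assume k: "0 < k"
      have "((\<lambda>w. P w u) has_derivative (\<lambda>h. \<chi> j. linform (\<lambda>i. P2 j i x u) h)) (at x within S)"
        by (rule has_derivative_vecI) (simp add: P2 xu k)
      then have Q: "((\<lambda>w. (w, P w u)) has_derivative (\<lambda>h. (h, \<chi> j. linform (\<lambda>i. P2 j i x u) h)))
          (at x within S)"
        by (intro has_derivative_Pair has_derivative_ident)
      have "((\<lambda>(x, u). f x u) has_derivative
          (\<lambda>(h, v). linform (\<lambda>i. f2 i x (P x u)) h + linform (\<lambda>i. f1 i x (P x u)) v))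
          (at (x, P x u) within S \<times> U)"
        by (rule has_derivative_joint[OF assms(1) xu(1) PU[OF xu] f1(2)
              mixed_C_continuous[OF f1(1)] f2(2)[OF k xu(1) PU[OF xu]]])
      then have "((\<lambda>(x, u). f x u) has_derivative
          (\<lambda>(h, v). linform (\<lambda>i. f2 i x (P x u)) h + linform (\<lambda>i. f1 i x (P x u)) v))
          (at (x, P x u) within (\<lambda>w. (w, P w u)) ` S)"
        by (rule has_derivative_subset) (use PU xu in auto)
      from has_derivative_in_compose[OF Q this]
      show "((\<lambda>w. f w (P w u)) has_derivative
          linform (\<lambda>i. f2 i x (P x u) + (\<Sum>j\<in>UNIV. f1 j x (P x u) * P2 j i x u))) (at x within S)"
        by (simp add: lin flip: linform_add)
    qed
  }
qed

text \<open>Bootstrap starting from continuity: the derivatives of \<open>P\<close> are built from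
  the inverse Jacobian and the x-derivatives of \<open>l\<close>, both evaluated at
  \<open>P\<close>. If \<open>P\<close> has order \<open>m\<close>, so have these by composition,
  and \<open>P\<close> has order \<open>m + 1\<close>. Each round uses one more order of
  \<open>l\<close>.\<close>

lemma mixed_C_implicit:
  fixes l P :: "real^'m::finite \<Rightarrow> real^'n::finite \<Rightarrow> real^'n"
  assumes "open U"
    and PU: "\<And>x u. x \<in> S \<Longrightarrow> u \<in> U \<Longrightarrow> P x u \<in> U"
    and l: "\<And>i m. mixed_C S U k m (\<lambda>x u. l x u $ i)"
    and nondeg: "\<And>x u D. x \<in> S \<Longrightarrow> u \<in> U \<Longrightarrow> (l x has_derivative D) (at u) \<Longrightarrow> inj D"
    and Pcont: "continuous_on (S \<times> U) (\<lambda>(x, u). P x u)"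
    and lP: "\<And>x u. x \<in> S \<Longrightarrow> u \<in> U \<Longrightarrow> l x (P x u) = u"
  shows "mixed_C S U k m (\<lambda>x u. P x u $ i)"
proof (induction m arbitrary: i)
  have c: "continuous_on (S \<times> U) (\<lambda>(x, u). P x u $ i)" for i
    using continuous_on_component[OF Pcont] by (simp add: case_prod_beta)
  {
    case 0
    show ?case using c by simp
  next
    case (Suc m)
    have "\<exists>g. (\<forall>i. mixed_C S U k m (g i)) \<and> (\<forall>x\<in>S. \<forall>u\<in>U.
        ((\<lambda>u. l x u $ j) has_derivative linform (\<lambda>i. g i x u)) (at u))" for j
      using mixed_C_sndE[OF l[of "Suc m" j]] by metis
    then obtain a where a: "\<And>j i. mixed_C S U k m (a j i)"
      "\<And>j x u. x \<in> S \<Longrightarrow> u \<in> U \<Longrightarrow>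
         ((\<lambda>u. l x u $ j) has_derivative linform (\<lambda>i. a j i x u)) (at u)"
      by metis
    have "\<exists>g. (\<forall>i. 0 < k \<longrightarrow> mixed_C S U (k - 1) m (g i)) \<and> (\<forall>x\<in>S. \<forall>u\<in>U. 0 < k \<longrightarrow>
        ((\<lambda>w. l w u $ j) has_derivative linform (\<lambda>i. g i x u)) (at x within S))" for j
      using mixed_C_fstE[OF l[of "Suc m" j]] by metis
    then obtain b where b: "\<And>j i. 0 < k \<Longrightarrow> mixed_C S U (k - 1) m (b j i)"
      "\<And>j x u. 0 < k \<Longrightarrow> x \<in> S \<Longrightarrow> u \<in> U \<Longrightarrow>
         ((\<lambda>w. l w u $ j) has_derivative linform (\<lambda>i. b j i x u)) (at x within S)"
      by metis
    define N where "N x u = (\<chi> i j. a i j x u)" for x u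
    \<comment> \<open>The entry in row \<open>r\<close> and column \<open>s\<close> of the inverse
      Jacobian by Cramer's rule: column \<open>r\<close> is replaced by the unit vector with index
      \<open>s\<close>. As a quotient of determinants it inherits the regularity of the
      entries.\<close>
    define R where "R r s x u =
      det (\<chi> i j. if j = r then axis s 1 $ i else a i j x u) * inverse (det (N x u))" for r s x u
    have row: "(N x u *v v) $ i = linform (\<lambda>j. a i j x u) v" for x u v i
      by (simp add: N_def matrix_vector_mult_def linform_def)
    have lN: "(l x has_derivative (\<lambda>v. N x u *v v)) (at u)" if "x \<in> S" "u \<in> U" for x u
      by (rule has_derivative_vecI) (simp add: row a that)
    have det: "det (N x u) \<noteq> 0" if "x \<in> S" "u \<in> U" for x u
      using nondeg[OF that lN[OF that]]
      by (metis invertible_det_nz invertible_left_inverse matrix_left_invertible_injective)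
    have R: "mixed_C S U k m (R r s)" for r s
      unfolding R_def
    proof (intro mixed_C_mult mixed_C_inverse mixed_C_det det)
      show "mixed_C S U k m
          (\<lambda>x u. (\<chi> i j. if j = r then axis s 1 $ i else a i j x u) $ i $ j)" for i j
        by (cases "j = r") (simp_all add: mixed_C_const a)
      show "mixed_C S U k m (\<lambda>x u. N x u $ i $ j)" for i j
        by (simp add: N_def a)
    qed
    define R' where "R' x u = (\<chi> r s. R r s x u)" for x u
    have R': "R' x u *v (N x u *v v) = v" if "x \<in> S" "u \<in> U" for x u v
    proof -
      have "N x u *v (\<chi> r. R' x u $ r $ s) = axis s 1" for s
        by (subst cramer[OF det[OF that]])
          (simp add: R'_def R_def N_def divide_inverse cong: if_cong)
      then have "N x u ** R' x u = mat 1"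
        by (simp add: vec_eq_iff matrix_matrix_mult_def matrix_vector_mult_def mat_def axis_def)
      \<comment> \<open>Cramer's rule yields a right inverse, while
        \<open>has_derivative_implicit\<close> asks for a left inverse.\<close>
      then have "R' x u ** N x u = mat 1" by (rule matrix_left_right_inverse[THEN iffD1])
      then show ?thesis by (simp add: matrix_vector_mul_assoc)
    qed
    have rowR: "(R' x u *v v) $ r = linform (\<lambda>s. R r s x u) v" for x u v r
      by (simp add: R'_def matrix_vector_mult_def linform_def)
    have RP: "mixed_C S U k m (\<lambda>x u. R r s x (P x u))" for r s
      by (rule mixed_C_compose[OF assms(1) PU R Suc.IH])
    show ?case
    proof (rule mixed_C_SucI[where g = "\<lambda>s x u. R i s x (P x u)"
          and h = "\<lambda>j x u. \<Sum>s\<in>UNIV. -1 * (R i s x (P x u) * b s j x (P x u))"])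
      show "continuous_on (S \<times> U) (\<lambda>(x, u). P x u $ i)" by (rule c)
      show "mixed_C S U k m (\<lambda>x u. R i s x (P x u))" for s by (rule RP)
      show "mixed_C S U (k - 1) m (\<lambda>x u. \<Sum>s\<in>UNIV. -1 * (R i s x (P x u) * b s j x (P x u)))"
        if k: "0 < k" for j
      proof -
        have "mixed_C S U (k - 1) m (\<lambda>x u. b s j x (P x u))" for s
          by (rule mixed_C_compose[OF assms(1) PU b(1)[OF k] Suc.IH[THEN mixed_C_less_fst]])
        then show ?thesis
          by (intro mixed_C_sum mixed_C_mult mixed_C_const RP[THEN mixed_C_less_fst])
      qed
    next
      fix x u assume xu: "x \<in> S" "u \<in> U"
      note Pxu = PU[OF xu]
      \<comment> \<open>Fibre direction: \<open>x\<close> is fixed, and \<open>p = P x w\<close>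
        solves \<open>l x p - w = 0\<close> with parameter \<open>w\<close>.\<close>
      have "((\<lambda>(w, p). l x p - w) has_derivative (\<lambda>(h, v). - h + N x (P x u) *v v))
          (at (u, P x u) within U \<times> U)"
      proof -
        have fst: "((\<lambda>z. fst z) has_derivative fst) (at (u, P x u) within U \<times> U)"
          and snd: "(snd has_derivative snd) (at (u, P x u) within U \<times> U)"
          by (auto intro!: bounded_linear_imp_has_derivative bounded_linear_fst bounded_linear_snd)
        have "(l x has_derivative (\<lambda>v. N x (P x u) *v v)) (at (snd (u, P x u)))"
          by (simp add: lN[OF xu(1) Pxu])
        from has_derivative_diff[OF has_derivative_compose[OF snd this] fst]
        show ?thesis by (simp add: case_prod_unfold)
      qed
      then have "(P x has_derivative (\<lambda>h. - (R' x (P x u) *v (- h)))) (at u within U)"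
      proof (rule has_derivative_implicit[where \<phi> = "P x" and X = U and Y = U and z = u
            and A = uminus and B = "\<lambda>v. N x (P x u) *v v" and B' = "\<lambda>v. R' x (P x u) *v v"])
        show "continuous (at u within U) (P x)"
        proof -
          have "continuous_on U (Pair x)" by (intro continuous_on_Pair continuous_on_const continuous_on_id)
          from continuous_on_compose2[OF Pcont this] have "continuous_on U (P x)" using xu by auto
          then show ?thesis using xu by (simp add: continuous_on_eq_continuous_within)
        qed
      qed (use xu PU lP R'[OF xu(1) Pxu] in \<open>auto intro: bounded_linear_minus bounded_linear_ident\<close>)
      then have "(P x has_derivative (\<lambda>h. R' x (P x u) *v h)) (at u)"
        using at_within_open[OF xu(2) assms(1)] by (simp add: vec.neg)
      from has_derivative_vec_nth[OF this]
      show "((\<lambda>u. P x u $ i) has_derivative linform (\<lambda>s. R i s x (P x u))) (at u)"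
        by (simp add: rowR)
      assume k: "0 < k"
      \<comment> \<open>Base direction: \<open>u\<close> is fixed, and \<open>p = P w u\<close>
        solves \<open>l w p = u\<close> with parameter \<open>w\<close> in \<open>S\<close>.\<close>
      have "((\<lambda>(x, u). l x u) has_derivative
          (\<lambda>(h, v). (\<chi> j. linform (\<lambda>i. b j i x (P x u)) h) + N x (P x u) *v v))
          (at (x, P x u) within S \<times> U)"
      proof (rule has_derivative_vecI)
        fix i
        have "((\<lambda>(x, u). l x u $ i) has_derivative
            (\<lambda>(h, v). linform (\<lambda>j. b i j x (P x u)) h + linform (\<lambda>j. a i j x (P x u)) v))
            (at (x, P x u) within S \<times> U)"
          by (rule has_derivative_joint[OF assms(1) xu(1) Pxu a(2)
                mixed_C_continuous[OF a(1)] b(2)[OF k xu(1) Pxu]])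
        then show "((\<lambda>z. (case z of (x, u) \<Rightarrow> l x u) $ i) has_derivative
            (\<lambda>z. (case z of (h, v) \<Rightarrow> (\<chi> j. linform (\<lambda>i. b j i x (P x u)) h) + N x (P x u) *v v) $ i))
            (at (x, P x u) within S \<times> U)"
          by (simp add: case_prod_unfold row)
      qed
      then have "((\<lambda>w. P w u) has_derivative
          (\<lambda>h. - (R' x (P x u) *v (\<chi> j. linform (\<lambda>i. b j i x (P x u)) h)))) (at x within S)"
      proof (rule has_derivative_implicit[where \<phi> = "\<lambda>w. P w u" and X = S and Y = U and z = x
            and A = "\<lambda>h. \<chi> j. linform (\<lambda>i. b j i x (P x u)) h"
            and B = "\<lambda>v. N x (P x u) *v v" and B' = "\<lambda>v. R' x (P x u) *v v"])
        show "continuous (at x within S) (\<lambda>w. P w u)"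
        proof -
          have "continuous_on S (\<lambda>w. (w, u))" by (intro continuous_on_Pair continuous_on_const continuous_on_id)
          from continuous_on_compose2[OF Pcont this] have "continuous_on S (\<lambda>w. P w u)" using xu by auto
          then show ?thesis using xu by (simp add: continuous_on_eq_continuous_within)
        qed
        show "bounded_linear (\<lambda>h. \<chi> j. linform (\<lambda>i. b j i x (P x u)) h)"
          \<comment> \<open>A map that is its own derivative at a point is bounded linear.\<close>
          by (rule has_derivative_bounded_linear[where F = "at 0" and f = "\<lambda>h. \<chi> j. linform (\<lambda>i. b j i x (P x u)) h"],
              rule has_derivative_vecI) (simp add: bounded_linear_imp_has_derivative)
      qed (use xu PU lP R'[OF xu(1) Pxu] in auto)
      from has_derivative_vec_nth[OF this, of i]
      show "((\<lambda>w. P w u $ i) has_derivative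
          linform (\<lambda>j. \<Sum>s\<in>UNIV. -1 * (R i s x (P x u) * b s j x (P x u)))) (at x within S)"
      proof (rule has_derivative_eq_rhs)
        show "(\<lambda>h. (- (R' x (P x u) *v (\<chi> j. linform (\<lambda>i. b j i x (P x u)) h))) $ i) =
            linform (\<lambda>j. \<Sum>s\<in>UNIV. -1 * (R i s x (P x u) * b s j x (P x u)))"
          unfolding linform_sum[symmetric] linform_cmult[symmetric]
          by (simp add: rowR fun_eq_iff) (simp add: linform_def sum_negf)
      qed
    qed
  }
qed

section \<open>From mixed regularity to anisotropic regularity\<close>

text \<open>\<open>frechet_derivative\<close> is a choice among the derivatives within a set. On a
  set of this kind the choice is forced, so it agrees with any coefficient function that has been
  found.\<close>

definition unique_derivatives :: "'a::real_normed_vector set \<Rightarrow> bool" where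
  "unique_derivatives S \<longleftrightarrow> (\<forall>(f :: 'a \<Rightarrow> real) D D' x. x \<in> S \<longrightarrow>
     (f has_derivative D) (at x within S) \<longrightarrow> (f has_derivative D') (at x within S) \<longrightarrow> D = D')"

lemma unique_derivativesD:
  "unique_derivatives S \<Longrightarrow> x \<in> S \<Longrightarrow> (f has_derivative D) (at x within S) \<Longrightarrow>
    frechet_derivative f (at x within S) = (D :: _ \<Rightarrow> real)"
  unfolding unique_derivatives_def by (metis differentiable_def frechet_derivative_works)

lemma unique_derivatives_open: "open S \<Longrightarrow> unique_derivatives S"
  unfolding unique_derivatives_def by (metis at_within_open has_derivative_unique)

text \<open>Both values are the limit of the same one-sided difference quotient along the
  ray.\<close>

lemma has_derivative_along_ray_unique:
  fixes f :: "'a::real_normed_vector \<Rightarrow> real"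
  assumes D: "(f has_derivative D) (at x within S)" and D': "(f has_derivative D') (at x within S)"
    and d: "d > 0" "\<And>t. 0 < t \<Longrightarrow> t < d \<Longrightarrow> x + t *\<^sub>R v \<in> S"
  shows "D v = D' v"
proof -
  have *: "((\<lambda>t. f (x + t *\<^sub>R v)) has_derivative (\<lambda>t. E (t *\<^sub>R v))) (at 0 within {0<..<d})"
    if "(f has_derivative E) (at x within S)" for E
  proof -
    have "((\<lambda>t. x + t *\<^sub>R v) has_derivative (\<lambda>t. t *\<^sub>R v)) (at 0 within {0<..<d})"
      by (auto intro!: derivative_eq_intros)
    moreover have "(f has_derivative E) (at (x + 0 *\<^sub>R v) within (\<lambda>t. x + t *\<^sub>R v) ` {0<..<d})"
      using has_derivative_subset[OF that, of "(\<lambda>t. x + t *\<^sub>R v) ` {0<..<d}"] d(2)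
      by (simp add: image_subset_iff)
    ultimately show ?thesis by (rule has_derivative_in_compose)
  qed
  have **: "((\<lambda>t. (f (x + t *\<^sub>R v) - f x) / t) \<longlongrightarrow> E v) (at 0 within {0<..<d})"
    if "(f has_derivative E) (at x within S)" for E
  proof -
    have "linear E" using that by (rule has_derivative_linear)
    then have "(\<lambda>t. E (t *\<^sub>R v)) = (*) (E v)" by (auto simp: linear_cmul)
    with *[OF that] have "((\<lambda>t. f (x + t *\<^sub>R v)) has_field_derivative E v) (at 0 within {0<..<d})"
      by (simp add: has_field_derivative_def)
    then show ?thesis by (simp add: has_field_derivative_iff)
  qed
  have "at 0 within {0<..<d} \<noteq> bot"
    using d(1) by (simp add: at_within_eq_bot_iff)
  from tendsto_unique[OF this **[OF D] **[OF D']] show ?thesis .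
qed

text \<open>At a boundary point every direction in which \<open>\<rho>\<close> increases to first
  order points into \<open>M\<close> for a short time. So \<open>D\<close> and \<open>D'\<close>
  agree on an open half-space, and a half-space spans.\<close>

lemma smooth_domain_unique_derivatives:
  fixes M :: "(real^'n::finite) set"
  assumes "smooth_domain M"
  shows "unique_derivatives M"
  unfolding unique_derivatives_def
proof (intro allI impI)
  fix f :: "real^'n \<Rightarrow> real" and D D' x
  assume x: "x \<in> M" and D: "(f has_derivative D) (at x within M)"
    and D': "(f has_derivative D') (at x within M)"
  show "D = D'"
  proof (cases "x \<in> interior M")
    case True
    show ?thesis
      using has_derivative_unique D D' unfolding at_within_interior[OF True] by blast
  next
    case False
    with x have "x \<in> M - interior M" by simp
    with assms obtain W \<rho> where W: "open W" "x \<in> W" "smooth_on W \<rho>"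
      and "\<forall>z\<in>W. \<exists>i. partial_deriv W i \<rho> z \<noteq> 0" and MW: "M \<inter> W = {z \<in> W. \<rho> z \<ge> 0}"
      unfolding smooth_domain_def by blast
    then have grad: "\<exists>i. partial_deriv W i \<rho> x \<noteq> 0" by blast
    have "C_k_on 1 W \<rho>" using W(3) by (simp add: smooth_on_def)
    then have "\<rho> differentiable (at x within W)"
      using W(2) unfolding C_k_on_def by (auto dest: spec[of _ "[]"])
    moreover define g where "g = frechet_derivative \<rho> (at x within W)"
    ultimately have g: "(\<rho> has_derivative g) (at x)"
      using W(1,2) by (metis at_within_open frechet_derivative_works)
    have lin: "linear g" "linear D" "linear D'"
      using g D D' has_derivative_linear by blast+
    have ray: "D v = D' v" if v: "g v > 0" for v
    proof -
      have "((\<lambda>t. x + t *\<^sub>R v) has_derivative (\<lambda>t. t *\<^sub>R v)) (at 0)"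
        by (auto intro!: derivative_eq_intros)
      from has_derivative_compose[OF this, of \<rho> g]
      have "((\<lambda>t. \<rho> (x + t *\<^sub>R v)) has_derivative (\<lambda>t. g (t *\<^sub>R v))) (at 0)"
        using g by simp
      moreover have "(\<lambda>t. g (t *\<^sub>R v)) = (*) (g v)" using lin(1) by (auto simp: linear_cmul)
      ultimately have "DERIV (\<lambda>t. \<rho> (x + t *\<^sub>R v)) 0 :> g v"
        by (simp add: has_field_derivative_def)
      from DERIV_pos_inc_right[OF this v] obtain d1 where d1: "d1 > 0"
        "\<And>t. 0 < t \<Longrightarrow> t < d1 \<Longrightarrow> \<rho> x < \<rho> (x + t *\<^sub>R v)"
        by auto
      have "isCont (\<lambda>t. x + t *\<^sub>R v) 0" by (intro continuous_intros)
      then have "\<forall>\<^sub>F t in at 0. x + t *\<^sub>R v \<in> W"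
        using W(1,2) unfolding isCont_def by (auto dest: topological_tendstoD)
      then obtain d2 where d2: "d2 > 0" "\<And>t. 0 < t \<Longrightarrow> t < d2 \<Longrightarrow> x + t *\<^sub>R v \<in> W"
        unfolding eventually_at by (auto simp: dist_real_def)
      have "\<rho> x \<ge> 0" using MW x W(2) by blast
      then have "x + t *\<^sub>R v \<in> M" if "0 < t" "t < min d1 d2" for t
        using MW d1(2)[of t] d2(2)[of t] that by fastforce
      then show ?thesis
        using has_derivative_along_ray_unique[OF D D', of "min d1 d2" v] d1(1) d2(1) by simp
    qed
    obtain i where "g (axis i 1) \<noteq> 0" using grad by (auto simp: partial_deriv_def g_def)
    then obtain e where e: "g e > 0"
      using lin(1) by (metis linear_neg linorder_neqE_linordered_idom neg_0_less_iff_less)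
    show "D = D'"
    proof
      fix w
      \<comment> \<open>Then \<open>g (w + s *\<^sub>R e) = g w + \<bar>g w\<bar> + 1\<close> is
        positive, and \<open>w\<close> is a linear combination of two directions already
        settled.\<close>
      define s where "s = (\<bar>g w\<bar> + 1) / g e"
      have "g (w + s *\<^sub>R e) > 0"
        using e lin(1) by (simp add: linear_add linear_cmul s_def)
      from ray[OF this] ray[OF e] show "D w = D' w"
        using lin by (simp add: linear_add linear_cmul)
    qed
  qed
qed

section \<open>Iterated partial derivatives and the anisotropic classes\<close>

lemma mixed_C_partials_snd:
  assumes "open U"
  shows "mixed_C S U k (m + length \<alpha>) f \<Longrightarrow> mixed_C S U k m (partials_snd U \<alpha> f)"
proof (induction \<alpha> arbitrary: m)
  case Nil
  then show ?case by (simp add: partials_snd_def)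
next
  case (Cons i \<alpha>)
  have IH: "mixed_C S U k (Suc m) (partials_snd U \<alpha> f)"
    using Cons by simp
  obtain g where g: "\<And>i. mixed_C S U k m (g i)"
    "\<And>x u. x \<in> S \<Longrightarrow> u \<in> U \<Longrightarrow> (partials_snd U \<alpha> f x has_derivative linform (\<lambda>i. g i x u)) (at u)"
    using mixed_C_sndE[OF IH] by blast
  show ?case
  proof (rule mixed_C_cong[OF g(1)[of i] assms])
    fix x u assume xu: "x \<in> S" "u \<in> U"
    have "frechet_derivative (partials_snd U \<alpha> f x) (at u within U) = linform (\<lambda>i. g i x u)"
      by (rule unique_derivativesD[OF unique_derivatives_open[OF assms] xu(2)
            has_derivative_at_withinI[OF g(2)[OF xu]]])
    moreover have "partials_snd U \<alpha> f x = partial_derivs U \<alpha> (f x)"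
      by (simp add: partials_snd_def fun_eq_iff)
    ultimately show "g i x u = partials_snd U (i # \<alpha>) f x u"
      by (simp add: partials_snd_def partial_deriv_def linform_axis)
  qed
qed

text \<open>Every base derivative spends one unit of both counters, whereas a fibre derivative
  spends only \<open>m\<close>. Uniqueness of derivatives identifies the coefficient function with
  the partial derivative at each stage.\<close>

lemma mixed_C_partials_fst:
  assumes "open U" "unique_derivatives S"
  shows "mixed_C S U (k + length \<alpha>) (m + length \<alpha>) f \<Longrightarrow> mixed_C S U k m (partials_fst S \<alpha> f)"
proof (induction \<alpha> arbitrary: m k)
  case Nil
  then show ?case by (simp add: partials_fst_def)
next
  case (Cons i \<alpha>)
  have IH: "mixed_C S U (Suc k) (Suc m) (partials_fst S \<alpha> f)"
    using Cons by simp
  obtain g where "\<And>i. 0 < Suc k \<Longrightarrow> mixed_C S U (Suc k - 1) m (g i)"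
    "\<And>x u. 0 < Suc k \<Longrightarrow> x \<in> S \<Longrightarrow> u \<in> U \<Longrightarrow>
      ((\<lambda>w. partials_fst S \<alpha> f w u) has_derivative linform (\<lambda>i. g i x u)) (at x within S)"
    using mixed_C_fstE[OF IH] by blast
  then have g: "\<And>i. mixed_C S U k m (g i)"
    "\<And>x u. x \<in> S \<Longrightarrow> u \<in> U \<Longrightarrow>
      ((\<lambda>w. partials_fst S \<alpha> f w u) has_derivative linform (\<lambda>i. g i x u)) (at x within S)"
    by simp_all
  show ?case
  proof (rule mixed_C_cong[OF g(1)[of i] assms(1)])
    fix x u assume xu: "x \<in> S" "u \<in> U"
    have "frechet_derivative (\<lambda>w. partials_fst S \<alpha> f w u) (at x within S) = linform (\<lambda>i. g i x u)"
      by (rule unique_derivativesD[OF assms(2) xu(1) g(2)[OF xu]])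
    moreover have "(\<lambda>w. partials_fst S \<alpha> f w u) = partial_derivs S \<alpha> (\<lambda>w. f w u)"
      by (simp add: partials_fst_def fun_eq_iff)
    ultimately show "g i x u = partials_fst S (i # \<alpha>) f x u"
      by (simp add: partials_fst_def partial_deriv_def linform_axis)
  qed
qed

lemma C_snd_if_mixed_C:
  assumes "open U" "\<And>m. mixed_C S U k m f"
  shows "C_snd l S U f"
  unfolding C_snd_def
proof (intro conjI allI impI ballI)
  fix \<alpha>
  note m = mixed_C_partials_snd[OF assms(1,2)]
  show "continuous_on (S \<times> U) (\<lambda>(v, u). partials_snd U \<alpha> f v u)"
    by (rule mixed_C_continuous[OF m])
  fix v u assume vu: "v \<in> S" "u \<in> U"
  show "partials_snd U \<alpha> f v differentiable (at u within U)"
    by (rule mixed_C_sndE[OF m]) (use vu in \<open>blast intro: differentiable_at_withinI differentiableI\<close>)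
qed

lemma C_fst_if_mixed_C:
  fixes S :: "(real^'m::finite) set"
  assumes "open U" "unique_derivatives S" "\<And>m. mixed_C S U k m f" "l \<le> k"
  shows "C_fst l S U f"
  unfolding C_fst_def
proof (intro conjI allI impI ballI)
  fix \<alpha> :: "'m list"
  have m: "mixed_C S U (k - length \<alpha>) m (partials_fst S \<alpha> f)" if "length \<alpha> \<le> k" for m
    by (rule mixed_C_partials_fst[OF assms(1,2)]) (use assms(3) that in simp)
  show "continuous_on (S \<times> U) (\<lambda>(v, u). partials_fst S \<alpha> f v u)" if "length \<alpha> \<le> l"
    by (rule mixed_C_continuous[OF m]) (use that assms(4) in simp)
  fix v u assume vu: "v \<in> S" "u \<in> U" and l: "length \<alpha> < l"
  show "(\<lambda>w. partials_fst S \<alpha> f w u) differentiable (at v within S)"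
    by (rule mixed_C_fstE[OF m])
      (use vu l assms(4) in \<open>auto intro: differentiableI\<close>)
qed

text \<open>With \<open>m\<close> unrestricted, fibre derivatives are free: all of \<open>k\<close>
  is left after any number of them, which covers the minimum in the definition, and after base
  derivatives the fibre order is still unlimited.\<close>

lemma C_aniso_inf_if_mixed_C:
  fixes S :: "(real^'m::finite) set" and U :: "(real^'n::finite) set"
  assumes "open U" "unique_derivatives S" "\<And>m. mixed_C S U k m f"
  shows "C_aniso_inf k S U f"
  unfolding C_aniso_inf_def C_aniso_def
proof (intro conjI allI impI)
  fix l and \<alpha> :: "'n list" and \<gamma> :: "'m list"
  show "C_fst k S U f" by (rule C_fst_if_mixed_C[OF assms]) simp
  show "C_snd l S U f" by (rule C_snd_if_mixed_C[OF assms(1,3)])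
  show "C_fst (min k (l - length \<alpha>)) S U (partials_snd U \<alpha> f)"
    by (rule C_fst_if_mixed_C[OF assms(1,2) mixed_C_partials_snd[OF assms(1,3)]]) simp
  assume "length \<gamma> \<le> k"
  then have "mixed_C S U (k - length \<gamma>) m (partials_fst S \<gamma> f)" for m
    by (intro mixed_C_partials_fst assms) (use assms(3) in simp)
  then show "C_snd (l - length \<gamma>) S U (partials_fst S \<gamma> f)"
    by (rule C_snd_if_mixed_C[OF assms(1)])
qed

text \<open>\<open>m\<close> may exceed \<open>k\<close>: the fibre coefficients vanish, and
  derivatives in x are demanded only while the first counter is positive.\<close>

lemma mixed_C_base:
  assumes "C_k_on k S f"
  shows "mixed_C S U k m (\<lambda>x u. f x)"
proof -
  have cont: "continuous_on (S \<times> U) (\<lambda>(x, u). partial_derivs S \<alpha> f x)" if "length \<alpha> \<le> k" for \<alpha>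
  proof -
    have "continuous_on S (partial_derivs S \<alpha> f)" using assms that by (simp add: C_k_on_def)
    from continuous_on_compose2[OF this, of "S \<times> U" fst] show ?thesis
      by (auto simp: case_prod_beta continuous_on_fst)
  qed
  have "mixed_C S U (k - length \<alpha>) m (\<lambda>x u. partial_derivs S \<alpha> f x)" if "length \<alpha> \<le> k" for \<alpha>
    using that
  proof (induction m arbitrary: \<alpha>)
    case 0
    then show ?case using cont by simp
  next
    case (Suc m)
    show ?case
    proof (rule mixed_C_SucI[where g = "\<lambda>i x u. 0" and h = "\<lambda>i x u. partial_derivs S (i # \<alpha>) f x"])
      fix i
      assume "0 < k - length \<alpha>"
      then show "mixed_C S U (k - length \<alpha> - 1) m (\<lambda>x u. partial_derivs S (i # \<alpha>) f x)"
        using Suc.IH[of "i # \<alpha>"] by simp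
    next
      fix x u assume "0 < k - length \<alpha>" and x: "x \<in> S"
      then have "partial_derivs S \<alpha> f differentiable (at x within S)"
        using assms by (simp add: C_k_on_def)
      then have D: "(partial_derivs S \<alpha> f has_derivative
          frechet_derivative (partial_derivs S \<alpha> f) (at x within S)) (at x within S)"
        by (simp add: frechet_derivative_works)
      from linform_linear[OF has_derivative_linear[OF D]] D
      show "((\<lambda>w. partial_derivs S \<alpha> f w) has_derivative
          linform (\<lambda>i. partial_derivs S (i # \<alpha>) f x)) (at x within S)"
        by (simp add: partial_deriv_def)
    qed (use cont Suc.prems in \<open>auto simp: linform_zero intro: mixed_C_const\<close>)
  qed
  from this[of "[]"] show ?thesis by simp
qed

section \<open>The largest eigenvalue of a symmetric matrix\<close>

lemma symmetric_matrix_inner: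
  fixes B :: "real^'n^'n::finite"
  assumes "transpose B = B"
  shows "(B *v v) \<bullet> w = v \<bullet> (B *v w)"
  by (metis assms dot_lmul_matrix transpose_matrix_vector)

text \<open>\<open>largest_eigenvalue\<close> is a \<open>Max\<close>, which is informative only on
  finite sets. Eigenvectors for distinct eigenvalues are orthogonal, and a pairwise orthogonal set
  is finite.\<close>

lemma finite_eigenvalues_symmetric:
  fixes B :: "real^'n^'n::finite"
  assumes "transpose B = B"
  shows "finite (eigenvalues B)"
proof -
  have "\<forall>\<mu>\<in>eigenvalues B. \<exists>v. v \<noteq> 0 \<and> B *v v = \<mu> *\<^sub>R v"
    by (simp add: eigenvalues_def)
  then obtain e where e: "\<And>\<mu>. \<mu> \<in> eigenvalues B \<Longrightarrow> e \<mu> \<noteq> 0 \<and> B *v e \<mu> = \<mu> *\<^sub>R e \<mu>"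
    by metis
  have "orthogonal (e \<mu>) (e \<nu>)" if "\<mu> \<in> eigenvalues B" "\<nu> \<in> eigenvalues B" "\<mu> \<noteq> \<nu>" for \<mu> \<nu>
    using symmetric_matrix_inner[OF assms, of "e \<mu>" "e \<nu>"] e[OF that(1)] e[OF that(2)] that(3)
    by (simp add: orthogonal_def)
  then have "pairwise orthogonal (e ` eigenvalues B)"
    unfolding pairwise_def by blast
  then have "finite (e ` eigenvalues B)" by (rule pairwise_orthogonal_imp_finite)
  moreover have "inj_on e (eigenvalues B)"
    by (rule inj_onI) (metis e scaleR_cancel_right)
  ultimately show ?thesis by (rule finite_imageD)
qed

text \<open>Let \<open>a\<close> maximize the form on the unit sphere, with value \<open>s\<close>.
  By homogeneity \<open>s * (v \<bullet> v) - v \<bullet> (B *v v)\<close> is nonnegative everywhere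
  and zero at \<open>a\<close>. Its unconstrained derivative vanishes there, which reads
  \<open>B *v a = s *\<^sub>R a\<close>; no multiplier is involved.\<close>

lemma rayleigh_quotient:
  fixes B :: "real^'n^'n::finite"
  assumes sym: "transpose B = B"
  obtains a where "norm a = 1" "B *v a = largest_eigenvalue B *\<^sub>R a"
    "\<And>v. v \<bullet> (B *v v) \<le> largest_eigenvalue B * (v \<bullet> v)"
proof -
  have cont: "continuous_on (sphere 0 1) (\<lambda>v. v \<bullet> (B *v v))"
    by (intro continuous_intros matrix_vector_mult_linear_continuous_on)
  have "sphere (0 :: real^'n) 1 \<noteq> {}" by simp
  then obtain a where a: "norm a = 1" and "\<And>u. norm u = 1 \<Longrightarrow> u \<bullet> (B *v u) \<le> a \<bullet> (B *v a)"
    using continuous_attains_sup[OF compact_sphere _ cont] by auto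
  moreover define s where "s = a \<bullet> (B *v a)"
  ultimately have s: "u \<bullet> (B *v u) \<le> s" if "norm u = 1" for u using that by simp
  have max: "v \<bullet> (B *v v) \<le> s * (v \<bullet> v)" for v
  proof (cases "v = 0")
    case False
    then have "(v /\<^sub>R norm v) \<bullet> (B *v (v /\<^sub>R norm v)) \<le> s" by (intro s) simp
    then have "(v \<bullet> (B *v v)) / (norm v * norm v) \<le> s"
      by (simp add: matrix_vector_mult_scaleR divide_inverse mult_ac)
    then show ?thesis using False by (simp add: divide_le_eq dot_square_norm power2_eq_square)
  qed simp
  have "((\<lambda>v. s * (v \<bullet> v) - v \<bullet> (B *v v)) has_derivative
      (\<lambda>h. s * (a \<bullet> h + h \<bullet> a) - (a \<bullet> (B *v h) + h \<bullet> (B *v a)))) (at a)"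
    by (intro has_derivative_diff has_derivative_mult_right has_derivative_inner has_derivative_ident
        bounded_linear_imp_has_derivative matrix_vector_mul_bounded_linear)
  then have zero: "(\<lambda>h. s * (a \<bullet> h + h \<bullet> a) - (a \<bullet> (B *v h) + h \<bullet> (B *v a))) = (\<lambda>h. 0)"
    by (rule differential_zero_maxmin[OF UNIV_I open_UNIV])
      (use max a in \<open>auto simp: s_def dot_square_norm\<close>)
  have "(s *\<^sub>R a - B *v a) \<bullet> h = 0" for h
    using fun_cong[OF zero, of h] symmetric_matrix_inner[OF sym, of a h]
    by (simp add: inner_diff_left inner_commute algebra_simps)
  then have eig: "B *v a = s *\<^sub>R a" by (metis inner_eq_zero_iff right_minus_eq)
  have "s \<in> eigenvalues B" using eig a unfolding eigenvalues_def by (auto intro!: exI[of _ a])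
  moreover have "\<mu> \<le> s" if "\<mu> \<in> eigenvalues B" for \<mu>
  proof -
    from that have "\<exists>v. v \<noteq> 0 \<and> B *v v = \<mu> *\<^sub>R v" by (simp add: eigenvalues_def)
    then obtain v where v: "v \<noteq> 0" "B *v v = \<mu> *\<^sub>R v" by (elim exE conjE)
    from max[of v] have "\<mu> * (v \<bullet> v) \<le> s * (v \<bullet> v)" unfolding v(2) inner_scaleR_right .
    then show ?thesis using v(1) by (simp add: mult_le_cancel_right)
  qed
  ultimately have "largest_eigenvalue B = s"
    unfolding largest_eigenvalue_def by (intro Max_eqI finite_eigenvalues_symmetric[OF sym])
  with a eig max that show thesis by blast
qed

lemma quadratic_form_le_sum_abs:
  fixes H :: "real^'n^'n::finite"
  assumes "norm a = 1"
  shows "\<bar>a \<bullet> (H *v a)\<bar> \<le> (\<Sum>i\<in>UNIV. \<Sum>j\<in>UNIV. \<bar>H $ i $ j\<bar>)"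
proof -
  have c: "\<bar>a $ i\<bar> \<le> 1" for i using component_le_norm_cart[of a i] assms by simp
  have "a \<bullet> (H *v a) = (\<Sum>i\<in>UNIV. \<Sum>j\<in>UNIV. a $ i * (H $ i $ j * a $ j))"
    by (simp add: inner_vec_def matrix_vector_mult_def sum_distrib_left)
  also have "\<bar>\<dots>\<bar> \<le> (\<Sum>i\<in>UNIV. \<Sum>j\<in>UNIV. \<bar>a $ i * (H $ i $ j * a $ j)\<bar>)"
    by (intro order_trans[OF sum_abs] sum_mono sum_abs)
  also have "\<dots> \<le> (\<Sum>i\<in>UNIV. \<Sum>j\<in>UNIV. \<bar>H $ i $ j\<bar>)"
  proof (intro sum_mono)
    fix i j
    have "\<bar>a $ i\<bar> * (\<bar>H $ i $ j\<bar> * \<bar>a $ j\<bar>) \<le> 1 * (\<bar>H $ i $ j\<bar> * 1)"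
      by (intro mult_mono c) auto
    then show "\<bar>a $ i * (H $ i $ j * a $ j)\<bar> \<le> \<bar>H $ i $ j\<bar>" by (simp add: abs_mult)
  qed
  finally show ?thesis .
qed

text \<open>The maximizer for \<open>B'\<close> competes for \<open>B\<close>, so the gap is at most
  the quadratic form of \<open>B' - B\<close> at that vector. Exchanging the matrices gives the
  two-sided bound.\<close>

lemma largest_eigenvalue_diff_le:
  fixes B B' :: "real^'n^'n::finite"
  assumes "transpose B = B" "transpose B' = B'"
  shows "largest_eigenvalue B' - largest_eigenvalue B \<le> (\<Sum>i\<in>UNIV. \<Sum>j\<in>UNIV. \<bar>B' $ i $ j - B $ i $ j\<bar>)"
proof -
  obtain a where a: "norm a = 1" "B' *v a = largest_eigenvalue B' *\<^sub>R a"
    using rayleigh_quotient[OF assms(2)] by blast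
  have "largest_eigenvalue B' - largest_eigenvalue B \<le> a \<bullet> (B' *v a) - a \<bullet> (B *v a)"
    using rayleigh_quotient[OF assms(1)] a by (metis diff_left_mono inner_scaleR_right mult.right_neutral
        norm_eq_1)
  also have "\<dots> = a \<bullet> ((B' - B) *v a)"
    by (simp add: matrix_vector_mult_diff_rdistrib inner_diff_right)
  also have "\<dots> \<le> (\<Sum>i\<in>UNIV. \<Sum>j\<in>UNIV. \<bar>(B' - B) $ i $ j\<bar>)"
    using quadratic_form_le_sum_abs[OF a(1), of "B' - B"] by linarith
  finally show ?thesis by simp
qed

lemma continuous_on_largest_eigenvalue:
  "continuous_on {B :: real^'n^'n::finite. transpose B = B} largest_eigenvalue"
  unfolding continuous_on_def
proof safe
  fix B :: "real^'n^'n" assume B: "transpose B = B"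
  let ?F = "at B within {B. transpose B = B}"
  have "((\<lambda>B'. largest_eigenvalue B' - largest_eigenvalue B) \<longlongrightarrow> 0) ?F"
  proof (rule Lim_null_comparison)
    show "\<forall>\<^sub>F B' in ?F. norm (largest_eigenvalue B' - largest_eigenvalue B)
        \<le> (\<Sum>i\<in>UNIV. \<Sum>j\<in>UNIV. \<bar>B' $ i $ j - B $ i $ j\<bar>)"
      unfolding eventually_at_filter
    proof (intro always_eventually allI impI)
      fix B' :: "real^'n^'n" assume "B' \<in> {B. transpose B = B}"
      then have "transpose B' = B'" by simp
      with largest_eigenvalue_diff_le[OF B this] largest_eigenvalue_diff_le[OF this B]
      show "norm (largest_eigenvalue B' - largest_eigenvalue B)
        \<le> (\<Sum>i\<in>UNIV. \<Sum>j\<in>UNIV. \<bar>B' $ i $ j - B $ i $ j\<bar>)"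
        by (simp add: abs_minus_commute abs_le_iff)
    qed
    have "((\<lambda>B'. \<Sum>i\<in>UNIV. \<Sum>j\<in>UNIV. \<bar>B' $ i $ j - B $ i $ j\<bar>)
        \<longlongrightarrow> (\<Sum>i\<in>UNIV. \<Sum>j\<in>UNIV. \<bar>B $ i $ j - B $ i $ j\<bar>)) ?F"
      by (intro tendsto_intros)
    then show "((\<lambda>B'. \<Sum>i\<in>UNIV. \<Sum>j\<in>UNIV. \<bar>B' $ i $ j - B $ i $ j\<bar>) \<longlongrightarrow> 0) ?F" by simp
  qed
  then show "(largest_eigenvalue \<longlongrightarrow> largest_eigenvalue B) ?F" by (simp add: LIM_zero_iff)
qed

text \<open>The partial derivative of the determinant by the entry in row \<open>i\<close> and
  column \<open>l\<close>: the Leibniz terms with \<open>\<pi> i = l\<close>, stripped of that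
  entry. In this form it is visibly a polynomial in the entries.\<close>

definition cofactor :: "real^'n^'n \<Rightarrow> 'n \<Rightarrow> 'n::finite \<Rightarrow> real" where
  "cofactor N i l = (\<Sum>\<pi> | \<pi> permutes UNIV.
     (if \<pi> i = l then of_int (sign \<pi>) * (\<Prod>j\<in>UNIV - {i}. N $ j $ \<pi> j) else 0))"

text \<open>Jacobi's formula: the product rule in each Leibniz term, regrouped by
  \<open>l = \<pi> i\<close>.\<close>

lemma det_has_derivative:
  fixes N :: "real^'n^'n::finite"
  shows "(det has_derivative (\<lambda>H. \<Sum>i\<in>UNIV. \<Sum>l\<in>UNIV. cofactor N i l * H $ i $ l)) (at N)"
proof -
  have nth: "((\<lambda>N. N $ i $ l) has_derivative (\<lambda>H. H $ i $ l)) (at N)" for i l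
    by (intro bounded_linear_imp_has_derivative bounded_linear_compose[OF bounded_linear_vec_nth]
        bounded_linear_vec_nth)
  have "((\<lambda>N. \<Sum>\<pi> | \<pi> permutes UNIV. of_int (sign \<pi>) * (\<Prod>i\<in>UNIV. N $ i $ \<pi> i)) has_derivative
      (\<lambda>H. \<Sum>\<pi> | \<pi> permutes UNIV. of_int (sign \<pi>) *
        (\<Sum>i\<in>UNIV. H $ i $ \<pi> i * (\<Prod>j\<in>UNIV - {i}. N $ j $ \<pi> j)))) (at N)"
    by (intro has_derivative_sum has_derivative_mult_right has_derivative_prod nth)
  moreover have "(\<Sum>\<pi> | \<pi> permutes UNIV. of_int (sign \<pi>) *
        (\<Sum>i\<in>UNIV. H $ i $ \<pi> i * (\<Prod>j\<in>UNIV - {i}. N $ j $ \<pi> j))) =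
      (\<Sum>i\<in>UNIV. \<Sum>l\<in>UNIV. cofactor N i l * H $ i $ l)" for H :: "real^'n^'n"
  proof -
    have "(\<Sum>l\<in>UNIV. cofactor N i l * H $ i $ l) = (\<Sum>\<pi> | \<pi> permutes UNIV.
        of_int (sign \<pi>) * (H $ i $ \<pi> i * (\<Prod>j\<in>UNIV - {i}. N $ j $ \<pi> j)))" for i
      unfolding cofactor_def sum_distrib_right
      by (subst sum.swap, simp add: if_distrib[where f = "\<lambda>a. a * b" for b] cong: if_cong)
        (simp add: mult_ac)
    then show ?thesis by (simp add: sum_distrib_left sum.swap[where A = UNIV])
  qed
  ultimately show ?thesis by (simp add: det_def[abs_def])
qed

section \<open>The characteristic polynomial and simple eigenvalues\<close>

lemma mat_minus_mult: "(mat t - B) *v v = t *\<^sub>R v - B *v v" for B :: "real^'n^'n::finite"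
  by (simp add: matrix_vector_mult_diff_rdistrib mat_def matrix_vector_mult_def vec_eq_iff
      left_diff_distrib sum_subtractf if_distrib[where f = "\<lambda>a. a * b" for b] cong: if_cong)

lemma eigenvalues_iff_det: "t \<in> eigenvalues B \<longleftrightarrow> det (mat t - B) = 0"
  for B :: "real^'n^'n::finite"
proof -
  have "t \<in> eigenvalues B \<longleftrightarrow> (\<exists>v. (mat t - B) *v v = 0 \<and> v \<noteq> 0)"
    unfolding eigenvalues_def mat_minus_mult by (simp add: conj_commute eq_commute[of "B *v _"])
  also have "\<dots> \<longleftrightarrow> det (mat t - B) = 0"
    using invertible_det_nz[of "mat t - B"] matrix_left_invertible_ker[of "mat t - B"]
      invertible_left_inverse[of "mat t - B"] by blast
  finally show ?thesis .
qed

lemma poly_charpoly: "poly (charpoly B) t = det (mat t - B)" for B :: "real^'n^'n::finite"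
proof -
  have "poly ((if i = j then [:0, 1:] else 0) - [:B $ i $ j:]) t = (mat t - B) $ i $ j" for i j
    by (simp add: mat_def)
  then show ?thesis
    by (simp add: charpoly_def det_def poly_sum poly_prod of_int_poly del: poly_diff)
qed

lemma has_derivative_mat_minus:
  "((\<lambda>(B, t). mat t - B) has_derivative (\<lambda>(H, v). mat v - H)) (at z within T)"
  for z :: "(real^'n^'n::finite) \<times> real"
proof (rule has_derivative_vecI, rule has_derivative_vecI)
  fix i l
  have "bounded_linear (\<lambda>z :: (real^'n^'n) \<times> real. fst z $ i $ l)"
    by (intro bounded_linear_compose[OF bounded_linear_vec_nth] bounded_linear_fst)
  then have 1: "((\<lambda>z :: (real^'n^'n) \<times> real. fst z $ i $ l) has_derivative (\<lambda>z. fst z $ i $ l)) (at z within T)"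
    by (rule bounded_linear_imp_has_derivative)
  have "((\<lambda>z. if i = l then snd z else 0) has_derivative (\<lambda>z :: (real^'n^'n) \<times> real. if i = l then snd z else 0)) (at z within T)"
    by (cases "i = l") (simp_all add: bounded_linear_imp_has_derivative bounded_linear_snd)
  from has_derivative_diff[OF this 1]
  show "((\<lambda>z. (case z of (B, t) \<Rightarrow> mat t - B) $ i $ l) has_derivative
      (\<lambda>z. (case z of (H, v) \<Rightarrow> mat v - H) $ i $ l)) (at z within T)"
    by (simp add: case_prod_unfold mat_def)
qed

text \<open>As \<open>t\<close> varies, \<open>mat t\<close> moves along the identity, so Jacobi's
  formula leaves the trace of the cofactors.\<close>

lemma charpoly_pderiv: "poly (pderiv (charpoly B)) t = (\<Sum>i\<in>UNIV. cofactor (mat t - B) i i)"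
  for B :: "real^'n^'n::finite"
proof -
  have "((\<lambda>t. (B, t)) has_derivative (\<lambda>v. (0, v))) (at t)"
    by (intro has_derivative_Pair has_derivative_const has_derivative_ident)
  from has_derivative_compose[OF this has_derivative_mat_minus]
  have "((\<lambda>t. mat t - B) has_derivative (\<lambda>v. mat v)) (at t)" by simp
  from has_derivative_compose[OF this det_has_derivative]
  have "((\<lambda>t. det (mat t - B)) has_derivative
      (\<lambda>v. \<Sum>i\<in>UNIV. \<Sum>l\<in>UNIV. cofactor (mat t - B) i l * mat v $ i $ l)) (at t)" .
  also have "(\<lambda>v. \<Sum>i\<in>UNIV. \<Sum>l\<in>UNIV. cofactor (mat t - B) i l * mat v $ i $ l) =
      (*) (\<Sum>i\<in>UNIV. cofactor (mat t - B) i i)"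
    by (simp add: fun_eq_iff mat_def sum_distrib_right if_distrib[where f = "\<lambda>a. b * a" for b] cong: if_cong)
  finally have "DERIV (poly (charpoly B)) t :> (\<Sum>i\<in>UNIV. cofactor (mat t - B) i i)"
    by (simp add: has_field_derivative_def poly_charpoly[abs_def])
  then show ?thesis using poly_DERIV DERIV_unique by blast
qed

text \<open>This is the nonzero t-derivative that implicit differentiation divides by: a root of
  order one splits off one linear factor, and the derivative at \<open>t\<close> is the value of the
  remaining factor \<open>q\<close>.\<close>

lemma simple_eigenvalue_cofactor:
  fixes B :: "real^'n^'n::finite"
  assumes "transpose B = B" "simple_eigenvalue B t"
  shows "(\<Sum>i\<in>UNIV. cofactor (mat t - B) i i) \<noteq> 0"
proof -
  \<comment> \<open>The decomposition by \<open>order\<close> requires a nonzero polynomial; the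
    zero polynomial would make every real number an eigenvalue.\<close>
  have nz: "charpoly B \<noteq> 0"
  proof
    assume "charpoly B = 0"
    then have "eigenvalues B = UNIV" using poly_charpoly[of B] by (auto simp: eigenvalues_iff_det)
    then show False using finite_eigenvalues_symmetric[OF assms(1)] by (simp add: infinite_UNIV_char_0)
  qed
  from order_decomp[OF nz, of t] assms(2) obtain q
    where q: "charpoly B = [:- t, 1:] * q" "\<not> [:- t, 1:] dvd q"
    by (auto simp: simple_eigenvalue_def)
  have "poly (pderiv (charpoly B)) t = poly q t"
    unfolding q(1) pderiv_mult by (simp add: pderiv_pCons)
  also have "\<dots> \<noteq> 0" using q(2) by (simp add: poly_eq_0_iff_dvd)
  finally show ?thesis by (simp add: charpoly_pderiv)
qed

text \<open>Implicit differentiation of \<open>det (mat t - B) = 0\<close> along the solution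
  \<open>t = largest_eigenvalue B\<close>. Its continuity is known among symmetric matrices, so the
  derivative is taken within that set.\<close>

lemma largest_eigenvalue_has_derivative:
  fixes B :: "real^'n^'n::finite"
  defines "N \<equiv> mat (largest_eigenvalue B) - B"
  assumes sym: "transpose B = B" and simple: "simple_eigenvalue B (largest_eigenvalue B)"
  shows "(largest_eigenvalue has_derivative
      (\<lambda>H. (\<Sum>i\<in>UNIV. \<Sum>l\<in>UNIV. cofactor N i l * H $ i $ l) * inverse (\<Sum>i\<in>UNIV. cofactor N i i)))
    (at B within {B. transpose B = B})"
proof -
  define \<tau> where "\<tau> = (\<Sum>i\<in>UNIV. cofactor N i i)"
  have \<tau>: "\<tau> \<noteq> 0" using simple_eigenvalue_cofactor[OF sym simple] by (simp add: \<tau>_def N_def)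
  \<comment> \<open>The sign comes from \<open>- B\<close> in \<open>mat t - B\<close>; the minus of
    the implicit formula cancels it.\<close>
  define A where "A H = - (\<Sum>i\<in>UNIV. \<Sum>l\<in>UNIV. cofactor N i l * H $ i $ l)" for H :: "real^'n^'n"
  let ?\<Lambda> = "largest_eigenvalue :: real^'n^'n \<Rightarrow> real"
  have A: "bounded_linear A"
    using has_derivative_bounded_linear[OF det_has_derivative[of N]]
    unfolding A_def by (rule bounded_linear_minus)
  have "(\<Sum>i\<in>UNIV. \<Sum>l\<in>UNIV. cofactor N i l * (mat v - H) $ i $ l) = A H + \<tau> * v" for H v
    by (simp add: A_def \<tau>_def mat_def right_diff_distrib sum_subtractf sum_distrib_right
        if_distrib[where f = "\<lambda>a. b * a" for b] cong: if_cong)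
  then have eq: "(\<lambda>(H, v). \<Sum>i\<in>UNIV. \<Sum>l\<in>UNIV. cofactor N i l * (mat v - H) $ i $ l) =
      (\<lambda>(H, v). A H + \<tau> * v)" by simp
  have "(det has_derivative (\<lambda>H. \<Sum>i\<in>UNIV. \<Sum>l\<in>UNIV. cofactor N i l * H $ i $ l))
      (at (case (B, ?\<Lambda> B) of (B, t) \<Rightarrow> mat t - B))"
    using det_has_derivative[of N] by (simp add: N_def)
  from has_derivative_compose[OF has_derivative_mat_minus this]
  have "((\<lambda>(B, t). det (mat t - B)) has_derivative (\<lambda>(H, v). A H + \<tau> * v))
      (at (B, ?\<Lambda> B) within {B. transpose B = B} \<times> UNIV)"
    unfolding eq[symmetric] by (simp add: case_prod_unfold)
  then have "(?\<Lambda> has_derivative (\<lambda>H. - (A H * inverse \<tau>))) (at B within {B. transpose B = B})"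
  proof (rule has_derivative_implicit[where \<phi> = ?\<Lambda> and X = "{B. transpose B = B}" and Y = UNIV
        and z = B and A = A and B = "(*) \<tau>" and B' = "\<lambda>w. w * inverse \<tau>"])
    show "continuous (at B within {B. transpose B = B}) ?\<Lambda>"
      using continuous_on_largest_eigenvalue[where 'n = 'n] sym by (simp add: continuous_on_eq_continuous_within)
    have "det (mat (?\<Lambda> B) - B) = 0" if B: "transpose B = B" for B :: "real^'n^'n"
    proof -
      obtain a where "norm a = 1" "B *v a = ?\<Lambda> B *\<^sub>R a"
        using rayleigh_quotient[OF B] by blast
      then show ?thesis
        unfolding eigenvalues_iff_det[symmetric] eigenvalues_def by (auto intro!: exI[of _ a])
    qed
    then show "(case (w, ?\<Lambda> w) of (B, t) \<Rightarrow> det (mat t - B)) =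
        (case (B, ?\<Lambda> B) of (B, t) \<Rightarrow> det (mat t - B))" if "w \<in> {B. transpose B = B}" for w
      using that sym by simp
  qed (use A sym \<tau> in \<open>auto intro: bounded_linear_mult_left\<close>)
  then show ?thesis by (simp add: A_def \<tau>_def)
qed

lemma mixed_C_cofactor:
  assumes "\<And>i j. mixed_C S U k m (\<lambda>x u. N x u $ i $ j)"
  shows "mixed_C S U k m (\<lambda>x u. cofactor (N x u) i l)"
  unfolding cofactor_def
proof (rule mixed_C_sum)
  fix \<pi>
  show "mixed_C S U k m
      (\<lambda>x u. if \<pi> i = l then of_int (sign \<pi>) * (\<Prod>j\<in>UNIV - {i}. N x u $ j $ \<pi> j) else 0)"
    by (cases "\<pi> i = l") (auto intro!: mixed_C_const mixed_C_mult mixed_C_prod assms)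
qed

text \<open>The derivative formula contains the eigenvalue through \<open>N\<close>, but
  undifferentiated, so order \<open>m\<close> of the eigenvalue yields order
  \<open>m + 1\<close>.\<close>

lemma mixed_C_largest_eigenvalue:
  fixes \<Gamma> :: "real^'m::finite \<Rightarrow> real^'n::finite \<Rightarrow> real^'d^'d::finite"
  assumes "open U"
    and \<Gamma>: "\<And>i j m. mixed_C S U k m (\<lambda>x u. \<Gamma> x u $ i $ j)"
    and sym: "\<And>x u. x \<in> S \<Longrightarrow> u \<in> U \<Longrightarrow> transpose (\<Gamma> x u) = \<Gamma> x u"
    and simple: "\<And>x u. x \<in> S \<Longrightarrow> u \<in> U \<Longrightarrow> simple_eigenvalue (\<Gamma> x u) (largest_eigenvalue (\<Gamma> x u))"
  shows "mixed_C S U k m (\<lambda>x u. largest_eigenvalue (\<Gamma> x u))"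
proof (induction m)
  have cont: "continuous_on (S \<times> U) (\<lambda>(x, u). largest_eigenvalue (\<Gamma> x u))"
  proof -
    have "continuous_on (S \<times> U) (\<lambda>z. \<chi> i j. \<Gamma> (fst z) (snd z) $ i $ j)"
      by (intro continuous_on_vec_lambda)
        (use \<Gamma>[THEN mixed_C_continuous] in \<open>auto simp: case_prod_unfold\<close>)
    then have "continuous_on (S \<times> U) (\<lambda>z. \<Gamma> (fst z) (snd z))" by simp
    moreover have "(\<lambda>z. \<Gamma> (fst z) (snd z)) ` (S \<times> U) \<subseteq> {B. transpose B = B}"
      using sym by auto
    ultimately show ?thesis
      unfolding case_prod_unfold by (rule continuous_on_compose2[OF continuous_on_largest_eigenvalue])
  qed
  {
    case 0
    show ?case using cont by simp
  next
    case (Suc m)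
    have "\<exists>g. (\<forall>i. mixed_C S U k m (g i)) \<and> (\<forall>x\<in>S. \<forall>u\<in>U.
        ((\<lambda>u. \<Gamma> x u $ i $ l) has_derivative linform (\<lambda>j. g j x u)) (at u))" for i l
      using mixed_C_sndE[OF \<Gamma>[of "Suc m" i l]] by metis
    then obtain a where a: "\<And>i l j. mixed_C S U k m (a i l j)"
      "\<And>i l x u. x \<in> S \<Longrightarrow> u \<in> U \<Longrightarrow>
         ((\<lambda>u. \<Gamma> x u $ i $ l) has_derivative linform (\<lambda>j. a i l j x u)) (at u)"
      by metis
    have "\<exists>g. (\<forall>i. 0 < k \<longrightarrow> mixed_C S U (k - 1) m (g i)) \<and> (\<forall>x\<in>S. \<forall>u\<in>U. 0 < k \<longrightarrow>
        ((\<lambda>w. \<Gamma> w u $ i $ l) has_derivative linform (\<lambda>j. g j x u)) (at x within S))" for i l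
      using mixed_C_fstE[OF \<Gamma>[of "Suc m" i l]] by metis
    then obtain b where b: "\<And>i l j. 0 < k \<Longrightarrow> mixed_C S U (k - 1) m (b i l j)"
      "\<And>i l x u. 0 < k \<Longrightarrow> x \<in> S \<Longrightarrow> u \<in> U \<Longrightarrow>
         ((\<lambda>w. \<Gamma> w u $ i $ l) has_derivative linform (\<lambda>j. b i l j x u)) (at x within S)"
      by metis
    define N where "N x u = mat (largest_eigenvalue (\<Gamma> x u)) - \<Gamma> x u" for x u
    have N: "mixed_C S U k m (\<lambda>x u. N x u $ i $ j)" for i j
    proof -
      have "mixed_C S U k m (\<lambda>x u. (if i = j then largest_eigenvalue (\<Gamma> x u) else 0) + - 1 * \<Gamma> x u $ i $ j)"
        by (intro mixed_C_add mixed_C_mult mixed_C_const \<Gamma>) (cases "i = j"; simp add: Suc mixed_C_const)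
      then show ?thesis by (simp add: N_def mat_def)
    qed
    have cof: "mixed_C S U k m (\<lambda>x u. cofactor (N x u) i l)" for i l
      by (rule mixed_C_cofactor[OF N])
    have inv: "mixed_C S U k m (\<lambda>x u. inverse (\<Sum>i\<in>UNIV. cofactor (N x u) i i))"
      by (rule mixed_C_inverse[OF mixed_C_sum[OF cof]])
        (use simple_eigenvalue_cofactor[OF sym simple] in \<open>simp add: N_def\<close>)
    have lin: "(\<Sum>i\<in>UNIV. \<Sum>l\<in>UNIV. p i l * linform (q i l) h) * r =
        linform (\<lambda>j. (\<Sum>i\<in>UNIV. \<Sum>l\<in>UNIV. p i l * q i l j) * r) h"
      for p :: "'d \<Rightarrow> 'd \<Rightarrow> real" and q :: "'d \<Rightarrow> 'd \<Rightarrow> 'e::finite \<Rightarrow> real" and r h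
      by (subst linform_cmult[THEN fun_cong] linform_sum[THEN fun_cong] mult.commute[of _ r])+ (rule refl)
    show ?case
    proof (rule mixed_C_SucI[where
          g = "\<lambda>j x u. (\<Sum>i\<in>UNIV. \<Sum>l\<in>UNIV. cofactor (N x u) i l * a i l j x u) * inverse (\<Sum>i\<in>UNIV. cofactor (N x u) i i)"
          and h = "\<lambda>j x u. (\<Sum>i\<in>UNIV. \<Sum>l\<in>UNIV. cofactor (N x u) i l * b i l j x u) * inverse (\<Sum>i\<in>UNIV. cofactor (N x u) i i)"])
      show "mixed_C S U k m (\<lambda>x u. (\<Sum>i\<in>UNIV. \<Sum>l\<in>UNIV. cofactor (N x u) i l * a i l j x u) *
          inverse (\<Sum>i\<in>UNIV. cofactor (N x u) i i))" for j
        by (intro mixed_C_mult[OF _ inv] mixed_C_sum mixed_C_mult cof a)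
      show "mixed_C S U (k - 1) m (\<lambda>x u. (\<Sum>i\<in>UNIV. \<Sum>l\<in>UNIV. cofactor (N x u) i l * b i l j x u) *
          inverse (\<Sum>i\<in>UNIV. cofactor (N x u) i i))" if "0 < k" for j
        by (intro mixed_C_mult[OF _ inv[THEN mixed_C_less_fst]] mixed_C_sum mixed_C_mult
            cof[THEN mixed_C_less_fst] b that)
    next
      fix x u assume xu: "x \<in> S" "u \<in> U"
      note L = largest_eigenvalue_has_derivative[OF sym[OF xu] simple[OF xu], folded N_def]
      have "(\<Gamma> x has_derivative (\<lambda>h. \<chi> i l. linform (\<lambda>j. a i l j x u) h)) (at u within U)"
        by (intro has_derivative_vecI) (simp add: a xu has_derivative_at_withinI)
      \<comment> \<open>The chain rule asks for a derivative only within the image of the fibre, and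
        that image consists of symmetric matrices.\<close>
      moreover have "(largest_eigenvalue has_derivative
          (\<lambda>H. (\<Sum>i\<in>UNIV. \<Sum>l\<in>UNIV. cofactor (N x u) i l * H $ i $ l) * inverse (\<Sum>i\<in>UNIV. cofactor (N x u) i i)))
          (at (\<Gamma> x u) within \<Gamma> x ` U)"
        by (rule has_derivative_subset[OF L]) (use sym xu in auto)
      ultimately have "((\<lambda>u. largest_eigenvalue (\<Gamma> x u)) has_derivative
          (\<lambda>h. (\<Sum>i\<in>UNIV. \<Sum>l\<in>UNIV. cofactor (N x u) i l * (\<chi> i l. linform (\<lambda>j. a i l j x u) h) $ i $ l)
            * inverse (\<Sum>i\<in>UNIV. cofactor (N x u) i i))) (at u within U)"
        by (rule has_derivative_in_compose)
      then show "((\<lambda>u. largest_eigenvalue (\<Gamma> x u)) has_derivative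
          linform (\<lambda>j. (\<Sum>i\<in>UNIV. \<Sum>l\<in>UNIV. cofactor (N x u) i l * a i l j x u) * inverse (\<Sum>i\<in>UNIV. cofactor (N x u) i i))) (at u)"
        using at_within_open[OF xu(2) assms(1)] by (simp add: lin)
      assume k: "0 < k"
      have "((\<lambda>w. \<Gamma> w u) has_derivative (\<lambda>h. \<chi> i l. linform (\<lambda>j. b i l j x u) h)) (at x within S)"
        by (intro has_derivative_vecI) (simp add: b xu k)
      moreover have "(largest_eigenvalue has_derivative
          (\<lambda>H. (\<Sum>i\<in>UNIV. \<Sum>l\<in>UNIV. cofactor (N x u) i l * H $ i $ l) * inverse (\<Sum>i\<in>UNIV. cofactor (N x u) i i)))
          (at (\<Gamma> x u) within (\<lambda>w. \<Gamma> w u) ` S)"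
        by (rule has_derivative_subset[OF L]) (use sym xu in auto)
      ultimately have "((\<lambda>w. largest_eigenvalue (\<Gamma> w u)) has_derivative
          (\<lambda>h. (\<Sum>i\<in>UNIV. \<Sum>l\<in>UNIV. cofactor (N x u) i l * (\<chi> i l. linform (\<lambda>j. b i l j x u) h) $ i $ l)
            * inverse (\<Sum>i\<in>UNIV. cofactor (N x u) i i))) (at x within S)"
        by (rule has_derivative_in_compose)
      then show "((\<lambda>w. largest_eigenvalue (\<Gamma> w u)) has_derivative
          linform (\<lambda>j. (\<Sum>i\<in>UNIV. \<Sum>l\<in>UNIV. cofactor (N x u) i l * b i l j x u) * inverse (\<Sum>i\<in>UNIV. cofactor (N x u) i i))) (at x within S)"
        by (simp add: lin)
    qed (rule cont)
  }
qed

section \<open>Strong convexity of the largest eigenvalue of the Christoffel matrix\<close>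

text \<open>For \<open>p = q\<close> this is the quadratic form of the Christoffel matrix at the
  polarization \<open>a\<close>. The two covector slots are kept apart to expand the form at a sum
  and to differentiate it in \<open>p\<close>.\<close>

definition tensor_form :: "'n tensor4 \<Rightarrow> real^'n \<Rightarrow> real^'n \<Rightarrow> real^'n::finite \<Rightarrow> real" where
  "tensor_form C a p q =
     (\<Sum>i\<in>UNIV. \<Sum>j\<in>UNIV. \<Sum>k\<in>UNIV. \<Sum>l\<in>UNIV. C i j k l * (a $ i * p $ j * q $ k * a $ l))"

lemma stiffness_tensor_swap:
  assumes "stiffness_tensor C"
  shows "C j i k l = C i j k l" "C i j l k = C i j k l" "C k l i j = C i j k l"
proof -
  show minor: "C j i k l = C i j k l" for i j k l
    using assms unfolding stiffness_tensor_def by blast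
  show major: "C k l i j = C i j k l" for i j k l
    using assms unfolding stiffness_tensor_def by blast
  have "C i j l k = C l k i j" by (rule major)
  also have "\<dots> = C k l i j" by (rule minor)
  also have "\<dots> = C i j k l" by (rule major)
  finally show "C i j l k = C i j k l" .
qed

text \<open>The index symmetries allow all four indices to be reversed; exchanging the summations
  over \<open>j\<close> and \<open>k\<close> does the rest.\<close>

lemma christoffel_symmetric:
  assumes "stiffness_tensor (c x)"
  shows "transpose (christoffel c x p) = christoffel c x p"
proof -
  have C: "c x l k j i = c x i j k l" for i j k l
  proof -
    have "c x l k j i = c x k l j i" by (rule stiffness_tensor_swap(1)[OF assms])
    also have "\<dots> = c x k l i j" by (rule stiffness_tensor_swap(2)[OF assms])
    also have "\<dots> = c x i j k l" by (rule stiffness_tensor_swap(3)[OF assms])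
    finally show ?thesis .
  qed
  have "(\<Sum>j\<in>UNIV. \<Sum>k\<in>UNIV. c x l j k i * p $ j * p $ k) =
      (\<Sum>j\<in>UNIV. \<Sum>k\<in>UNIV. c x i j k l * p $ j * p $ k)" for i l
  proof -
    have "(\<Sum>j\<in>UNIV. \<Sum>k\<in>UNIV. c x l j k i * p $ j * p $ k) =
        (\<Sum>j\<in>UNIV. \<Sum>k\<in>UNIV. c x l k j i * p $ k * p $ j)"
      by (rule sum.swap)
    also have "\<dots> = (\<Sum>j\<in>UNIV. \<Sum>k\<in>UNIV. c x i j k l * p $ j * p $ k)"
      by (intro sum.cong refl) (metis C mult.assoc mult.commute)
    finally show ?thesis .
  qed
  then show ?thesis by (simp add: vec_eq_iff transpose_def christoffel_def)
qed

lemma christoffel_quadratic_form: "a \<bullet> (christoffel c x p *v a) = tensor_form (c x) a p p"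
proof -
  have "a \<bullet> (christoffel c x p *v a) = (\<Sum>i\<in>UNIV. \<Sum>l\<in>UNIV. \<Sum>j\<in>UNIV. \<Sum>k\<in>UNIV.
      c x i j k l * (a $ i * p $ j * p $ k * a $ l))"
    by (simp add: inner_vec_def matrix_vector_mult_def christoffel_def sum_distrib_left
        sum_distrib_right mult_ac)
  also have "\<dots> = tensor_form (c x) a p p"
    unfolding tensor_form_def
  proof (rule sum.cong[OF refl])
    fix i
    have "(\<Sum>l\<in>UNIV. \<Sum>j\<in>UNIV. \<Sum>k\<in>UNIV. c x i j k l * (a $ i * p $ j * p $ k * a $ l)) =
        (\<Sum>j\<in>UNIV. \<Sum>l\<in>UNIV. \<Sum>k\<in>UNIV. c x i j k l * (a $ i * p $ j * p $ k * a $ l))"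
      by (rule sum.swap)
    also have "\<dots> = (\<Sum>j\<in>UNIV. \<Sum>k\<in>UNIV. \<Sum>l\<in>UNIV. c x i j k l * (a $ i * p $ j * p $ k * a $ l))"
      by (rule sum.cong[OF refl sum.swap])
    finally show "(\<Sum>l\<in>UNIV. \<Sum>j\<in>UNIV. \<Sum>k\<in>UNIV. c x i j k l * (a $ i * p $ j * p $ k * a $ l)) = \<dots>" .
  qed
  finally show ?thesis .
qed

lemma tensor_form_add:
  "tensor_form C a (p + q) (p + q) = tensor_form C a p p + (tensor_form C a p q + tensor_form C a q p)
     + tensor_form C a q q"
  by (simp add: tensor_form_def sum.distrib algebra_simps)

lemma tensor_form_scaleR: "tensor_form C a (t *\<^sub>R p) (t *\<^sub>R p) = t\<^sup>2 * tensor_form C a p p"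
  by (simp add: tensor_form_def sum_distrib_left power2_eq_square mult_ac)

lemma tensor_form_zero [simp]: "tensor_form C a 0 0 = 0"
  by (simp add: tensor_form_def)

lemma tensor_form_has_derivative:
  "((\<lambda>p. tensor_form C a p p) has_derivative (\<lambda>h. tensor_form C a p h + tensor_form C a h p)) (at p)"
proof -
  have nth: "((\<lambda>p. p $ j) has_derivative (\<lambda>h. h $ j)) (at p)" for j
    by (rule bounded_linear_imp_has_derivative[OF bounded_linear_vec_nth])
  have "((\<lambda>p. tensor_form C a p p) has_derivative (\<lambda>h. \<Sum>i\<in>UNIV. \<Sum>j\<in>UNIV. \<Sum>k\<in>UNIV. \<Sum>l\<in>UNIV.
      C i j k l * (a $ i * a $ l * (p $ j * h $ k + h $ j * p $ k)))) (at p)"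
    unfolding tensor_form_def
  proof (intro has_derivative_sum)
    fix i j k l
    have "((\<lambda>p. C i j k l * (a $ i * a $ l * (p $ j * p $ k))) has_derivative
        (\<lambda>h. C i j k l * (a $ i * a $ l * (p $ j * h $ k + h $ j * p $ k)))) (at p)"
      by (intro has_derivative_mult_right has_derivative_mult nth)
    then show "((\<lambda>p. C i j k l * (a $ i * p $ j * p $ k * a $ l)) has_derivative
        (\<lambda>h. C i j k l * (a $ i * a $ l * (p $ j * h $ k + h $ j * p $ k)))) (at p)"
      by (simp add: mult_ac)
  qed
  then show ?thesis
    by (simp add: tensor_form_def distrib_left sum.distrib mult_ac)
qed

text \<open>Positivity is tested on the symmetrized product of \<open>a\<close> and
  \<open>p\<close>. The expansion has four terms, equal to each other by the symmetries inside the
  two index pairs.\<close>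

lemma tensor_form_pos:
  assumes C: "stiffness_tensor C" "positive_definite_tensor C" and "a \<noteq> 0" "p \<noteq> 0"
  shows "tensor_form C a p p > 0"
proof -
  define A :: "real^'a^'a" where "A = (\<chi> i j. a $ i * p $ j + a $ j * p $ i)"
  have "A \<noteq> 0"
  proof
    assume "A = 0"
    then have z: "a $ i * p $ j + a $ j * p $ i = 0" for i j
      by (simp add: A_def vec_eq_iff)
    \<comment> \<open>A diagonal entry with \<open>p $ j \<noteq> 0\<close> forces
      \<open>a $ j = 0\<close>; the rest of that column then forces \<open>a = 0\<close>.\<close>
    obtain j where j: "p $ j \<noteq> 0" using assms(4) by (auto simp: vec_eq_iff)
    then have "a $ j = 0" using z[of j j] by simp
    then have "a $ i = 0" for i using z[of i j] j by simp
    then show False using assms(3) by (simp add: vec_eq_iff)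
  qed
  moreover have "transpose A = A" by (simp add: A_def transpose_def vec_eq_iff add.commute)
  ultimately have "0 < (\<Sum>i\<in>UNIV. \<Sum>j\<in>UNIV. \<Sum>k\<in>UNIV. \<Sum>l\<in>UNIV. C i j k l * A $ i $ j * A $ k $ l)"
    using C(2) by (simp add: positive_definite_tensor_def)
  also have "\<dots> = 4 * tensor_form C a p p"
  proof -
    have sym1: "C j i k l = C i j k l" and sym2: "C i j l k = C i j k l" for i j k l
      using stiffness_tensor_swap[OF C(1)] by blast+
    have ij: "(\<Sum>i\<in>UNIV. \<Sum>j\<in>UNIV. \<Sum>k\<in>UNIV. \<Sum>l\<in>UNIV. C i j k l * (f j i k l)) =
        (\<Sum>i\<in>UNIV. \<Sum>j\<in>UNIV. \<Sum>k\<in>UNIV. \<Sum>l\<in>UNIV. C i j k l * (f i j k l))" for f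
      by (subst sum.swap) (simp add: sym1)
    have kl: "(\<Sum>i\<in>UNIV. \<Sum>j\<in>UNIV. \<Sum>k\<in>UNIV. \<Sum>l\<in>UNIV. C i j k l * (f i j l k)) =
        (\<Sum>i\<in>UNIV. \<Sum>j\<in>UNIV. \<Sum>k\<in>UNIV. \<Sum>l\<in>UNIV. C i j k l * (f i j k l))" for f
      by (rule sum.cong[OF refl], rule sum.cong[OF refl], subst sum.swap) (simp add: sym2)
    let ?f = "\<lambda>i j k l. a $ i * p $ j * p $ k * a $ l"
    have "(\<Sum>i\<in>UNIV. \<Sum>j\<in>UNIV. \<Sum>k\<in>UNIV. \<Sum>l\<in>UNIV. C i j k l * A $ i $ j * A $ k $ l) =
      (\<Sum>i\<in>UNIV. \<Sum>j\<in>UNIV. \<Sum>k\<in>UNIV. \<Sum>l\<in>UNIV. C i j k l * ?f i j k l) +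
      (\<Sum>i\<in>UNIV. \<Sum>j\<in>UNIV. \<Sum>k\<in>UNIV. \<Sum>l\<in>UNIV. C i j k l * ?f i j l k) +
      ((\<Sum>i\<in>UNIV. \<Sum>j\<in>UNIV. \<Sum>k\<in>UNIV. \<Sum>l\<in>UNIV. C i j k l * ?f j i k l) +
       (\<Sum>i\<in>UNIV. \<Sum>j\<in>UNIV. \<Sum>k\<in>UNIV. \<Sum>l\<in>UNIV. C i j k l * ?f j i l k))"
      unfolding sum.distrib[symmetric] by (intro sum.cong refl) (simp add: A_def algebra_simps)
    then show ?thesis
      unfolding kl[of ?f] ij[of ?f] kl[of "\<lambda>i j k l. ?f j i k l"]
      by (simp add: tensor_form_def)
  qed
  finally show ?thesis by simp
qed

lemma tensor_form_diff_le:
  assumes "norm a = 1"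
  shows "\<bar>tensor_form C' a p p - tensor_form C a p p\<bar> \<le>
    (\<Sum>i\<in>UNIV. \<Sum>j\<in>UNIV. \<Sum>k\<in>UNIV. \<Sum>l\<in>UNIV. \<bar>C' i j k l - C i j k l\<bar>) * (p \<bullet> p)"
proof -
  have a: "\<bar>a $ i\<bar> \<le> 1" for i using component_le_norm_cart[of a i] assms by simp
  have p: "\<bar>p $ i\<bar> \<le> norm p" for i by (rule component_le_norm_cart)
  have "tensor_form C' a p p - tensor_form C a p p =
    (\<Sum>i\<in>UNIV. \<Sum>j\<in>UNIV. \<Sum>k\<in>UNIV. \<Sum>l\<in>UNIV. (C' i j k l - C i j k l) * (a $ i * p $ j * p $ k * a $ l))"
    by (simp add: tensor_form_def left_diff_distrib sum_subtractf)
  also have "\<bar>\<dots>\<bar> \<le> (\<Sum>i\<in>UNIV. \<Sum>j\<in>UNIV. \<Sum>k\<in>UNIV. \<Sum>l\<in>UNIV.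
      \<bar>(C' i j k l - C i j k l) * (a $ i * p $ j * p $ k * a $ l)\<bar>)"
    by (intro order_trans[OF sum_abs] sum_mono sum_abs)
  also have "\<dots> \<le> (\<Sum>i\<in>UNIV. \<Sum>j\<in>UNIV. \<Sum>k\<in>UNIV. \<Sum>l\<in>UNIV. \<bar>C' i j k l - C i j k l\<bar> * (p \<bullet> p))"
  proof (intro sum_mono)
    fix i j k l
    have "\<bar>a $ i\<bar> * \<bar>p $ j\<bar> * \<bar>p $ k\<bar> * \<bar>a $ l\<bar> \<le> 1 * norm p * norm p * 1"
      by (intro mult_mono a p) auto
    then have "\<bar>a $ i * p $ j * p $ k * a $ l\<bar> \<le> p \<bullet> p"
      by (simp add: abs_mult dot_square_norm power2_eq_square)
    then show "\<bar>(C' i j k l - C i j k l) * (a $ i * p $ j * p $ k * a $ l)\<bar> \<le> \<bar>C' i j k l - C i j k l\<bar> * (p \<bullet> p)"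
      unfolding abs_mult[of "C' i j k l - C i j k l"] by (intro mult_left_mono) auto
  qed
  also have "\<dots> = (\<Sum>i\<in>UNIV. \<Sum>j\<in>UNIV. \<Sum>k\<in>UNIV. \<Sum>l\<in>UNIV. \<bar>C' i j k l - C i j k l\<bar>) * (p \<bullet> p)"
    by (simp add: sum_distrib_right)
  finally show ?thesis .
qed

text \<open>Strong ellipticity, uniform over unit polarizations. Unlike bare positivity it carries a
  constant, which can be transported to nearby base points.\<close>

definition coercive_tensor :: "real \<Rightarrow> 'n::finite tensor4 \<Rightarrow> bool" where
  "coercive_tensor \<mu> C \<longleftrightarrow> (\<forall>a p. norm a = 1 \<longrightarrow> \<mu> * (p \<bullet> p) \<le> tensor_form C a p p)"

text \<open>The constant is the minimum over a product of two unit spheres; quadratic homogeneity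
  extends the bound to all covectors.\<close>

lemma positive_definite_coercive:
  assumes "stiffness_tensor C" "positive_definite_tensor C"
  obtains \<mu> where "\<mu> > 0" "coercive_tensor \<mu> C"
proof -
  have "continuous_on (sphere 0 1 \<times> sphere 0 1) (\<lambda>z. tensor_form C (fst z) (snd z) (snd z))"
    unfolding tensor_form_def by (intro continuous_intros)
  from continuous_attains_inf[OF compact_Times[OF compact_sphere compact_sphere] _ this]
  obtain a p where ap: "norm a = 1" "norm p = 1"
    and min: "\<And>b q. norm b = 1 \<Longrightarrow> norm q = 1 \<Longrightarrow> tensor_form C a p p \<le> tensor_form C b q q"
    by auto
  show thesis
  proof (rule that[of "tensor_form C a p p"])
    show "0 < tensor_form C a p p"
      using ap by (intro tensor_form_pos assms) auto
    show "coercive_tensor (tensor_form C a p p) C"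
      unfolding coercive_tensor_def
    proof (intro allI impI)
      fix b q :: "real^'a" assume b: "norm b = 1"
      show "tensor_form C a p p * (q \<bullet> q) \<le> tensor_form C b q q"
      proof (cases "q = 0")
        case False
        have "tensor_form C b q q = (norm q)\<^sup>2 * tensor_form C b (q /\<^sub>R norm q) (q /\<^sub>R norm q)"
          using False unfolding tensor_form_scaleR[symmetric] by simp
        moreover have "tensor_form C a p p \<le> tensor_form C b (q /\<^sub>R norm q) (q /\<^sub>R norm q)"
          using False by (intro min b) simp
        then have "(norm q)\<^sup>2 * tensor_form C a p p
            \<le> (norm q)\<^sup>2 * tensor_form C b (q /\<^sub>R norm q) (q /\<^sub>R norm q)"
          by (rule mult_left_mono) simp
        ultimately show ?thesis
          unfolding dot_square_norm by (metis mult.commute)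
      qed simp
    qed
  qed
qed

text \<open>The source of local uniformity in x: a continuous field loses little of its constant
  near a point.\<close>

lemma coercive_tensor_perturb:
  assumes "coercive_tensor \<mu> C"
    and "(\<Sum>i\<in>UNIV. \<Sum>j\<in>UNIV. \<Sum>k\<in>UNIV. \<Sum>l\<in>UNIV. \<bar>C' i j k l - C i j k l\<bar>) \<le> \<delta>"
  shows "coercive_tensor (\<mu> - \<delta>) C'"
  unfolding coercive_tensor_def
proof (intro allI impI)
  fix a p :: "real^'a" assume a: "norm a = 1"
  have "\<mu> * (p \<bullet> p) \<le> tensor_form C a p p" using assms(1) a by (simp add: coercive_tensor_def)
  moreover have "\<bar>tensor_form C' a p p - tensor_form C a p p\<bar> \<le> \<delta> * (p \<bullet> p)"
    by (rule order_trans[OF tensor_form_diff_le[OF a] mult_right_mono[OF assms(2)]]) simp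
  ultimately show "(\<mu> - \<delta>) * (p \<bullet> p) \<le> tensor_form C' a p p" by (simp add: algebra_simps)
qed

section \<open>The eigenvalue as a maximum of quadratic forms\<close>

lemma lambda_qP_attained:
  assumes "stiffness_tensor (c x)"
  obtains a where "norm a = 1" "lambda_qP c x p = tensor_form (c x) a p p"
proof -
  obtain a where a: "norm a = 1"
    "christoffel c x p *v a = largest_eigenvalue (christoffel c x p) *\<^sub>R a"
    using rayleigh_quotient[OF christoffel_symmetric[where c = c and x = x and p = p, OF assms]] by blast
  then have "lambda_qP c x p = tensor_form (c x) a p p"
    unfolding lambda_qP_def christoffel_quadratic_form[symmetric] by (simp add: dot_square_norm)
  with a(1) show thesis by (rule that)
qed

lemma tensor_form_le_lambda_qP:
  assumes "stiffness_tensor (c x)" "norm a = 1"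
  shows "tensor_form (c x) a p p \<le> lambda_qP c x p"
proof -
  have "a \<bullet> (christoffel c x p *v a) \<le> largest_eigenvalue (christoffel c x p) * (a \<bullet> a)"
    using rayleigh_quotient[OF christoffel_symmetric[where c = c and x = x and p = p, OF assms(1)]] by blast
  then show ?thesis
    using assms(2) by (simp add: lambda_qP_def christoffel_quadratic_form dot_square_norm)
qed

lemma lambda_qP_zero: "stiffness_tensor (c x) \<Longrightarrow> lambda_qP c x 0 = 0"
  using lambda_qP_attained[of c x 0] by (metis tensor_form_zero)

lemma lambda_qP_ge:
  assumes "stiffness_tensor (c x)" "coercive_tensor \<mu> (c x)"
  shows "\<mu> * (p \<bullet> p) \<le> lambda_qP c x p"
proof -
  obtain a where "norm a = 1" "lambda_qP c x p = tensor_form (c x) a p p"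
    using lambda_qP_attained[of c x, OF assms(1)] by blast
  then show ?thesis using assms(2) by (simp add: coercive_tensor_def)
qed

lemma lambda_qP_scaleR_le:
  assumes "stiffness_tensor (c x)"
  shows "lambda_qP c x (t *\<^sub>R p) \<le> t\<^sup>2 * lambda_qP c x p"
proof -
  obtain a where "norm a = 1" "lambda_qP c x (t *\<^sub>R p) = tensor_form (c x) a (t *\<^sub>R p) (t *\<^sub>R p)"
    using lambda_qP_attained[of c x, OF assms(1)] by blast
  then show ?thesis
    using tensor_form_le_lambda_qP[of c x a p, OF assms] by (simp add: tensor_form_scaleR mult_left_mono)
qed

text \<open>At \<open>p\<close> the function \<open>\<lambda>\<close> touches the quadratic form of a maximizing polarization from above, so
  both have the same gradient there.\<close>

lemma lambda_qP_strongly_convex: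
  assumes st: "stiffness_tensor (c x)" and co: "coercive_tensor \<mu> (c x)"
    and D: "(lambda_qP c x has_derivative D) (at p)"
  shows "lambda_qP c x p + D (q - p) + \<mu> * ((q - p) \<bullet> (q - p)) \<le> lambda_qP c x q"
proof -
  obtain a where a: "norm a = 1" "lambda_qP c x p = tensor_form (c x) a p p"
    using lambda_qP_attained[of c x, OF st] by blast
  have "((\<lambda>p. lambda_qP c x p - tensor_form (c x) a p p) has_derivative
      (\<lambda>h. D h - (tensor_form (c x) a p h + tensor_form (c x) a h p))) (at p)"
    by (intro has_derivative_diff tensor_form_has_derivative D)
  then have "(\<lambda>h. D h - (tensor_form (c x) a p h + tensor_form (c x) a h p)) = (\<lambda>h. 0)"
    by (rule differential_zero_maxmin[OF UNIV_I open_UNIV])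
      (use tensor_form_le_lambda_qP[of c x a, OF st a(1)] a(2) in simp)
  then have D': "D h = tensor_form (c x) a p h + tensor_form (c x) a h p" for h
    by (metis eq_iff_diff_eq_0)
  have "tensor_form (c x) a (p + (q - p)) (p + (q - p)) \<le> lambda_qP c x q"
    using tensor_form_le_lambda_qP[of c x a q, OF st a(1)] by simp
  moreover have "\<mu> * ((q - p) \<bullet> (q - p)) \<le> tensor_form (c x) a (q - p) (q - p)"
    using co a(1) by (simp add: coercive_tensor_def)
  ultimately show ?thesis unfolding tensor_form_add D' a(2) by linarith
qed

lemma mixed_C_christoffel:
  assumes "C_k_tensor_field k M c"
  shows "mixed_C M U k m (\<lambda>x p. christoffel c x p $ i $ l)"
proof -
  have "mixed_C M U k m (\<lambda>x p. c x i j k' l)" for j k'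
    using assms by (intro mixed_C_base) (simp add: C_k_tensor_field_def)
  then show ?thesis
    unfolding christoffel_def vec_lambda_beta
    by (intro mixed_C_sum mixed_C_mult mixed_C_fibre_coord)
qed

text \<open>The zero covector is included, because the minimization behind surjectivity runs over a
  ball around it.\<close>

lemma continuous_on_lambda_qP:
  assumes "stiffness_tensor (c x)"
  shows "continuous_on UNIV (lambda_qP c x)"
proof -
  have "continuous_on UNIV (christoffel c x)"
    unfolding christoffel_def by (intro continuous_intros)
  moreover have "range (christoffel c x) \<subseteq> {B. transpose B = B}"
    using christoffel_symmetric[of c x, OF assms] by auto
  ultimately have "continuous_on UNIV (\<lambda>p. largest_eigenvalue (christoffel c x p))"
    by (rule continuous_on_compose2[OF continuous_on_largest_eigenvalue])
  then show ?thesis by (simp add: lambda_qP_def[abs_def])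
qed

section \<open>The Legendre map\<close>

locale separate_qP =
  fixes M :: "(real^'n::finite) set" and c :: "real^'n \<Rightarrow> 'n tensor4" and k :: nat
  assumes stiffness: "x \<in> M \<Longrightarrow> stiffness_tensor (c x)"
    and positive: "x \<in> M \<Longrightarrow> positive_definite_tensor (c x)"
    and regular: "C_k_tensor_field k M c"
    and separate: "qP_globally_separate M c"
begin

definition momentum_gradient :: "real^'n \<Rightarrow> real^'n \<Rightarrow> real^'n" where
  "momentum_gradient x p = (\<chi> i. partial_deriv (- {0}) i (\<lambda>q. lambda_qP c x q / 2) p)"

lemma legendre_qP_eq: "legendre_qP c (x, p) = (x, momentum_gradient x p)"
  by (simp add: legendre_qP_def momentum_gradient_def)

lemma mixed_C_lambda_qP: "mixed_C M (- {0}) k m (lambda_qP c)"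
proof -
  have "mixed_C M (- {0}) k m (\<lambda>x p. largest_eigenvalue (christoffel c x p))"
    using separate
    by (intro mixed_C_largest_eigenvalue mixed_C_christoffel[OF regular] christoffel_symmetric stiffness)
      (auto simp: qP_globally_separate_def lambda_qP_def)
  then show ?thesis by (simp add: lambda_qP_def[abs_def])
qed

text \<open>The fibre derivative is paid for with \<open>m\<close> alone, so the gradient is as
  regular in x as the eigenvalue.\<close>

lemma mixed_C_momentum_gradient: "mixed_C M (- {0}) k m (\<lambda>x p. momentum_gradient x p $ i)"
proof -
  have "mixed_C M (- {0}) k (m + length [i]) (\<lambda>x p. lambda_qP c x p * (1 / 2))"
    by (intro mixed_C_mult mixed_C_lambda_qP mixed_C_const)
  then have "mixed_C M (- {0}) k m (partials_snd (- {0}) [i] (\<lambda>x p. lambda_qP c x p * (1 / 2)))"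
    by (rule mixed_C_partials_snd[rotated]) (simp add: open_Compl)
  then show ?thesis
    by (simp add: partials_snd_def[abs_def] momentum_gradient_def)
qed

lemma lambda_qP_has_derivative:
  assumes x: "x \<in> M" and p: "p \<noteq> 0"
  shows "(lambda_qP c x has_derivative (\<lambda>h. 2 * (momentum_gradient x p \<bullet> h))) (at p)"
proof -
  obtain g where "\<And>i. mixed_C M (- {0}) k 0 (g i)"
    and g': "\<And>x u. x \<in> M \<Longrightarrow> u \<in> - {0} \<Longrightarrow>
      (lambda_qP c x has_derivative linform (\<lambda>i. g i x u)) (at u)"
    using mixed_C_sndE[OF mixed_C_lambda_qP[of "Suc 0"]] by blast
  have g: "(lambda_qP c x has_derivative linform (\<lambda>i. g i x p)) (at p)"
    by (rule g') (use x p in auto)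
  from has_derivative_mult_left[OF this, of "1 / 2"]
  have "((\<lambda>q. lambda_qP c x q / 2) has_derivative (\<lambda>h. linform (\<lambda>i. g i x p) h / 2)) (at p)"
    by simp
  from unique_derivativesD[OF unique_derivatives_open _ has_derivative_at_withinI[OF this], of "- {0}"] p
  have "frechet_derivative (\<lambda>q. lambda_qP c x q / 2) (at p within - {0}) =
      (\<lambda>h. linform (\<lambda>i. g i x p) h / 2)"
    by (simp add: open_Compl)
  then have "g i x p = 2 * momentum_gradient x p $ i" for i
    by (simp add: momentum_gradient_def partial_deriv_def linform_axis)
  then have "linform (\<lambda>i. g i x p) = (\<lambda>h. 2 * (momentum_gradient x p \<bullet> h))"
    by (simp add: linform_def inner_vec_def fun_eq_iff sum_distrib_left field_simps)
  with g show ?thesis by simp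
qed

section \<open>Strong monotonicity, bijectivity and nondegeneracy of the Legendre map\<close>

lemma lambda_qP_subgradient:
  assumes "x \<in> M" "p \<noteq> 0" "coercive_tensor \<mu> (c x)"
  shows "lambda_qP c x p + 2 * (momentum_gradient x p \<bullet> (q - p)) + \<mu> * ((q - p) \<bullet> (q - p))
    \<le> lambda_qP c x q"
  by (rule lambda_qP_strongly_convex[OF stiffness[OF assms(1)] assms(3)
        lambda_qP_has_derivative[OF assms(1,2)]])

text \<open>The sum of the convexity inequalities based at \<open>p\<close> and at \<open>q\<close>.
  These are global in the other point, so a segment through the zero covector does no harm.\<close>

lemma momentum_gradient_monotone:
  assumes "x \<in> M" "p \<noteq> 0" "q \<noteq> 0" "coercive_tensor \<mu> (c x)"
  shows "\<mu> * ((q - p) \<bullet> (q - p)) \<le> (momentum_gradient x q - momentum_gradient x p) \<bullet> (q - p)"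
proof -
  have "(p - q) \<bullet> (p - q) = (q - p) \<bullet> (q - p)" by (simp add: algebra_simps inner_commute)
  moreover have "momentum_gradient x q \<bullet> (p - q) = - (momentum_gradient x q \<bullet> (q - p))"
    by (simp add: inner_diff_right)
  ultimately show ?thesis
    using lambda_qP_subgradient[of x p \<mu> q] lambda_qP_subgradient[of x q \<mu> p] assms
    by (simp add: inner_diff_left)
qed

lemma norm_momentum_gradient_diff_ge:
  assumes "x \<in> M" "p \<noteq> 0" "q \<noteq> 0" "coercive_tensor \<mu> (c x)"
  shows "\<mu> * norm (q - p) \<le> norm (momentum_gradient x q - momentum_gradient x p)"
proof (cases "q = p")
  case False
  have "\<mu> * norm (q - p) * norm (q - p) \<le> (momentum_gradient x q - momentum_gradient x p) \<bullet> (q - p)"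
    using momentum_gradient_monotone[OF assms] by (simp add: dot_square_norm power2_eq_square mult.assoc)
  also have "\<dots> \<le> norm (momentum_gradient x q - momentum_gradient x p) * norm (q - p)"
    by (rule norm_cauchy_schwarz)
  finally show ?thesis using False by simp
qed simp

lemma lambda_qP_pos:
  assumes "x \<in> M" "p \<noteq> 0"
  shows "lambda_qP c x p > 0"
proof -
  obtain \<mu> where "\<mu> > 0" "coercive_tensor \<mu> (c x)"
    using positive_definite_coercive[OF stiffness positive] assms(1) by blast
  with lambda_qP_ge[of c x \<mu> p, OF stiffness[OF assms(1)]] assms(2) show ?thesis
    by (smt (verit) inner_gt_zero_iff mult_pos_pos)
qed

lemma momentum_gradient_inj:
  assumes "x \<in> M" "p \<noteq> 0" "q \<noteq> 0" "momentum_gradient x p = momentum_gradient x q"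
  shows "p = q"
proof -
  obtain \<mu> where \<mu>: "\<mu> > 0" "coercive_tensor \<mu> (c x)"
    using positive_definite_coercive[OF stiffness positive] assms(1) by blast
  from norm_momentum_gradient_diff_ge[OF assms(1-3) \<mu>(2)] assms(4)
  have "\<mu> * norm (q - p) \<le> 0" by simp
  then show ?thesis using \<mu>(1) by (simp add: mult_le_0_iff)
qed

text \<open>The preimage of \<open>y\<close> is the minimizer of the strictly convex coercive function
  \<open>p \<mapsto> \<lambda>(x, p) / 2 - y \<bullet> p\<close>.\<close>

lemma momentum_gradient_surj:
  assumes x: "x \<in> M" and y: "y \<noteq> 0"
  shows "\<exists>p. p \<noteq> 0 \<and> momentum_gradient x p = y"
proof -
  note st = stiffness[OF x]
  obtain \<mu> where \<mu>: "\<mu> > 0" "coercive_tensor \<mu> (c x)"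
    using positive_definite_coercive[OF stiffness positive] x by blast
  define f where "f p = lambda_qP c x p - 2 * (y \<bullet> p)" for p
  \<comment> \<open>Outside this ball the quadratic lower bound dominates the linear term, so
    \<open>f\<close> is at least \<open>0 = f 0\<close> there and the minimum over the ball is
    global.\<close>
  define R where "R = 2 * norm y / \<mu>"
  have "continuous_on (cball 0 R) f"
    unfolding f_def
    by (intro continuous_intros continuous_on_subset[OF continuous_on_lambda_qP[of c x, OF st]]) simp
  moreover have R: "R \<ge> 0" using \<mu>(1) by (simp add: R_def)
  then have "cball (0 :: real^'n) R \<noteq> {}" by simp
  ultimately obtain p where p: "\<And>q. norm q \<le> R \<Longrightarrow> f p \<le> f q"
    using continuous_attains_inf[OF compact_cball] by (metis mem_cball_0)
  have f0: "f 0 = 0" using lambda_qP_zero[of c x, OF st] by (simp add: f_def)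
  have min: "f p \<le> f q" for q
  proof (cases "norm q \<le> R")
    case False
    then have "2 * norm y \<le> \<mu> * norm q" using \<mu>(1) by (simp add: R_def field_simps)
    then have "2 * norm y * norm q \<le> \<mu> * norm q * norm q" by (rule mult_right_mono) simp
    also have "\<mu> * norm q * norm q \<le> lambda_qP c x q"
      using lambda_qP_ge[of c x \<mu> q, OF st \<mu>(2)] by (simp add: dot_square_norm power2_eq_square mult.assoc)
    finally have "0 \<le> f q" using norm_cauchy_schwarz[of y q] by (simp add: f_def)
    moreover have "f p \<le> 0" using p[of 0] R f0 by simp
    ultimately show ?thesis by simp
  qed (rule p)
  \<comment> \<open>The derivative of the eigenvalue is available only off zero. The minimizer is
    not zero because \<open>f\<close> takes negative values on the ray through
    \<open>y\<close>.\<close>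
  have "p \<noteq> 0"
  proof
    assume "p = 0"
    \<comment> \<open>The minimizer of the upper bound
      \<open>t\<^sup>2 * lambda_qP c x y - 2 * t * (y \<bullet> y)\<close> of \<open>f\<close> on
      that ray.\<close>
    define t where "t = (y \<bullet> y) / lambda_qP c x y"
    have pos: "lambda_qP c x y > 0" "y \<bullet> y > 0" using lambda_qP_pos[OF x y] y by auto
    then have t: "t > 0" "t * lambda_qP c x y = y \<bullet> y" by (auto simp: t_def)
    have "f (t *\<^sub>R y) \<le> t\<^sup>2 * lambda_qP c x y - 2 * (t * (y \<bullet> y))"
      using lambda_qP_scaleR_le[of c x t y, OF st] by (simp add: f_def)
    also have "t\<^sup>2 * lambda_qP c x y = t * (y \<bullet> y)"
      using t(2) by (simp add: power2_eq_square mult.assoc)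
    also have "t * (y \<bullet> y) - 2 * (t * (y \<bullet> y)) < 0" using mult_pos_pos[OF t(1) pos(2)] by simp
    finally show False using min[of "t *\<^sub>R y"] f0 \<open>p = 0\<close> by simp
  qed
  have "(f has_derivative (\<lambda>h. 2 * (momentum_gradient x p \<bullet> h) - 2 * (y \<bullet> h))) (at p)"
    unfolding f_def
    by (intro has_derivative_diff lambda_qP_has_derivative[OF x \<open>p \<noteq> 0\<close>] has_derivative_mult_right
        bounded_linear_imp_has_derivative bounded_linear_inner_right)
  then have "(\<lambda>h. 2 * (momentum_gradient x p \<bullet> h) - 2 * (y \<bullet> h)) = (\<lambda>h. 0)"
    by (rule differential_zero_maxmin[OF UNIV_I open_UNIV]) (use min in simp)
  then have "(momentum_gradient x p - y) \<bullet> h = 0" for h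
    by (simp add: fun_eq_iff inner_diff_left)
  then have "momentum_gradient x p = y" by (metis inner_eq_zero_iff right_minus_eq)
  with \<open>p \<noteq> 0\<close> show ?thesis by blast
qed

text \<open>Strong monotonicity along \<open>p + t *\<^sub>R v\<close> passes to the derivative as
  \<open>D v \<bullet> v \<ge> \<mu> * (v \<bullet> v)\<close>, so the kernel is trivial.\<close>

lemma momentum_gradient_nondegenerate:
  assumes x: "x \<in> M" and p: "p \<noteq> 0" and D: "(momentum_gradient x has_derivative D) (at p)"
  shows "inj D"
proof -
  obtain \<mu> where \<mu>: "\<mu> > 0" "coercive_tensor \<mu> (c x)"
    using positive_definite_coercive[OF stiffness positive] x by blast
  have lin: "linear D" using D by (rule has_derivative_linear)
  have "\<mu> * (v \<bullet> v) \<le> D v \<bullet> v" if "v \<noteq> 0" for v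
  proof (rule ccontr)
    assume "\<not> \<mu> * (v \<bullet> v) \<le> D v \<bullet> v"
    then have neg: "D v \<bullet> v - \<mu> * (v \<bullet> v) < 0" by simp
    have "((\<lambda>t. p + t *\<^sub>R v) has_derivative (\<lambda>t. t *\<^sub>R v)) (at 0)"
      by (auto intro!: derivative_eq_intros)
    from has_derivative_compose[OF this, of "momentum_gradient x" D] D
    have "((\<lambda>t. momentum_gradient x (p + t *\<^sub>R v)) has_derivative (\<lambda>t. D (t *\<^sub>R v))) (at 0)"
      by simp
    from has_derivative_inner_left[OF this, of v]
    have "((\<lambda>t. momentum_gradient x (p + t *\<^sub>R v) \<bullet> v) has_derivative (\<lambda>t. D (t *\<^sub>R v) \<bullet> v)) (at 0)" .
    moreover have "(\<lambda>t. D (t *\<^sub>R v) \<bullet> v) = (*) (D v \<bullet> v)"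
      using lin by (simp add: linear_cmul fun_eq_iff)
    ultimately have "DERIV (\<lambda>t. momentum_gradient x (p + t *\<^sub>R v) \<bullet> v) 0 :> D v \<bullet> v"
      by (simp add: has_field_derivative_def)
    then have "DERIV (\<lambda>t. momentum_gradient x (p + t *\<^sub>R v) \<bullet> v - t * (\<mu> * (v \<bullet> v))) 0 :> D v \<bullet> v - \<mu> * (v \<bullet> v)"
      by (auto intro!: derivative_eq_intros)
    from DERIV_neg_dec_right[OF this neg] obtain d where d: "d > 0" "\<And>h. 0 < h \<Longrightarrow> h < d \<Longrightarrow>
        momentum_gradient x (p + h *\<^sub>R v) \<bullet> v - h * (\<mu> * (v \<bullet> v)) < momentum_gradient x p \<bullet> v"
      by auto
    \<comment> \<open>The first bound stays within the range of strict decrease; the second keeps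
      \<open>p + t *\<^sub>R v\<close> nonzero, as monotonicity demands.\<close>
    define t where "t = min (d / 2) (norm p / (2 * norm v))"
    have t: "t > 0" "t < d" using d(1) p that by (auto simp: t_def)
    have "norm (t *\<^sub>R v) < norm p"
    proof -
      have "t * norm v \<le> norm p / (2 * norm v) * norm v" unfolding t_def by (intro mult_right_mono) auto
      also have "\<dots> < norm p" using p that by simp
      finally show ?thesis using t(1) by simp
    qed
    then have "p + t *\<^sub>R v \<noteq> 0" by (metis add_eq_0_iff less_irrefl norm_minus_cancel)
    from momentum_gradient_monotone[OF x p this \<mu>(2)]
    have "t * (t * (\<mu> * (v \<bullet> v))) \<le> t * ((momentum_gradient x (p + t *\<^sub>R v) - momentum_gradient x p) \<bullet> v)"
      by (simp add: mult_ac)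
    then have "t * (\<mu> * (v \<bullet> v)) \<le> (momentum_gradient x (p + t *\<^sub>R v) - momentum_gradient x p) \<bullet> v"
      using t(1) by (simp only: mult_le_cancel_left_pos)
    then show False using d(2)[OF t] by (simp add: inner_diff_left)
  qed
  then have "D v \<noteq> 0" if "v \<noteq> 0" for v
    using that \<mu>(1) by (metis inner_gt_zero_iff inner_zero_left linorder_not_le mult_pos_pos)
  then show ?thesis using lin by (auto simp: linear_injective_0)
qed

section \<open>The inverse Legendre map and the Finsler function\<close>

definition momentum_inverse :: "real^'n \<Rightarrow> real^'n \<Rightarrow> real^'n" where
  "momentum_inverse x y = (SOME p. p \<noteq> 0 \<and> momentum_gradient x p = y)"

lemma momentum_inverse:
  assumes "x \<in> M" "y \<noteq> 0"
  shows "momentum_inverse x y \<noteq> 0" "momentum_gradient x (momentum_inverse x y) = y"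
  using someI_ex[OF momentum_gradient_surj[OF assms]] by (auto simp: momentum_inverse_def)

text \<open>The comparison is made in the fibre over the moving base point. There the covectors
  \<open>momentum_inverse (fst z) (snd z)\<close> and \<open>p\<close> have gradients
  \<open>snd z\<close> and \<open>momentum_gradient (fst z) p\<close>, which both tend to
  \<open>y\<close>, and strong monotonicity bounds the distance of the covectors by that of the
  gradients.\<close>

lemma continuous_on_momentum_inverse:
  "continuous_on (M \<times> (- {0})) (\<lambda>(x, y). momentum_inverse x y)"
  unfolding continuous_on_def
proof
  fix z0 :: "(real^'n) \<times> (real^'n)" assume "z0 \<in> M \<times> (- {0})"
  then obtain x y where z0: "z0 = (x, y)" and x: "x \<in> M" and y: "y \<noteq> 0" by auto
  let ?F = "at (x, y) within M \<times> (- {0})"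
  define p where "p = momentum_inverse x y"
  have p: "p \<noteq> 0" "momentum_gradient x p = y" using momentum_inverse[OF x y] by (auto simp: p_def)
  obtain \<mu> where \<mu>: "\<mu> > 0" "coercive_tensor \<mu> (c x)"
    using positive_definite_coercive[OF stiffness positive] x by blast
  let ?N = "\<lambda>z. \<Sum>i\<in>UNIV. \<Sum>j\<in>UNIV. \<Sum>k\<in>UNIV. \<Sum>l\<in>UNIV. \<bar>c (fst z) i j k l - c x i j k l\<bar>"
  have fst: "(fst \<longlongrightarrow> x) ?F" and snd: "(snd \<longlongrightarrow> y) ?F"
    using tendsto_fst[OF tendsto_ident_at[of "(x, y)" "M \<times> (- {0})"]]
      tendsto_snd[OF tendsto_ident_at[of "(x, y)" "M \<times> (- {0})"]] by simp_all
  have inM: "\<forall>\<^sub>F z in ?F. z \<in> M \<times> (- {0})" by (simp add: eventually_at_filter)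
  have "((\<lambda>z. c (fst z) i j k' l) \<longlongrightarrow> c x i j k' l) ?F" for i j k' l
  proof -
    have "C_k_on k M (\<lambda>x. c x i j k' l)" using regular by (simp add: C_k_tensor_field_def)
    from mixed_C_continuous[OF mixed_C_base[OF this, of "- {0}" 0]]
    show ?thesis using x y by (auto simp: continuous_on_def case_prod_unfold)
  qed
  then have "(?N \<longlongrightarrow> (\<Sum>i\<in>UNIV. \<Sum>j\<in>UNIV. \<Sum>k\<in>UNIV. \<Sum>l\<in>UNIV. \<bar>c x i j k l - c x i j k l\<bar>)) ?F"
    by (intro tendsto_intros)
  then have "(?N \<longlongrightarrow> 0) ?F" by simp
  then have "\<forall>\<^sub>F z in ?F. ?N z < \<mu> / 2"
    by (rule order_tendstoD(2)) (use \<mu>(1) in simp)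
  then have "\<forall>\<^sub>F z in ?F. norm (momentum_inverse (fst z) (snd z) - p) \<le>
      2 / \<mu> * norm (snd z - momentum_gradient (fst z) p)"
    using inM
  proof eventually_elim
    case (elim z)
    then have z: "fst z \<in> M" "snd z \<noteq> 0" by auto
    \<comment> \<open>Near \<open>x\<close> the perturbation costs at most half of
      \<open>\<mu>\<close>; the other half produces the factor \<open>2 / \<mu>\<close>.\<close>
    have "coercive_tensor (\<mu> - \<mu> / 2) (c (fst z))"
      by (rule coercive_tensor_perturb[OF \<mu>(2)]) (use elim(1) in simp)
    then have "coercive_tensor (\<mu> / 2) (c (fst z))" by simp
    from norm_momentum_gradient_diff_ge[OF z(1) p(1) momentum_inverse(1)[OF z] this]
    show ?case using \<mu>(1) momentum_inverse(2)[OF z] by (simp add: field_simps)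
  qed
  moreover have "((\<lambda>z. 2 / \<mu> * norm (snd z - momentum_gradient (fst z) p)) \<longlongrightarrow> 2 / \<mu> * norm (y - y)) ?F"
  proof (intro tendsto_intros snd)
    have "continuous_on M (\<lambda>x. (x, p))" by (intro continuous_on_Pair continuous_on_const continuous_on_id)
    from continuous_on_compose2[OF mixed_C_vec_continuous[OF mixed_C_momentum_gradient] this]
    have "continuous_on M (\<lambda>x. momentum_gradient x p)" using p(1) by auto
    then have "continuous_on (M \<times> (- {0})) (\<lambda>z. momentum_gradient (fst z) p)"
      by (rule continuous_on_compose2[OF _ continuous_on_fst[OF continuous_on_id]]) auto
    then have "((\<lambda>z. momentum_gradient (fst z) p) \<longlongrightarrow> momentum_gradient x p) ?F"
      using x y by (auto simp: continuous_on_def)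
    then show "((\<lambda>z. momentum_gradient (fst z) p) \<longlongrightarrow> y) ?F" using p(2) by simp
  qed
  then have "((\<lambda>z. 2 / \<mu> * norm (snd z - momentum_gradient (fst z) p)) \<longlongrightarrow> 0) ?F" by simp
  ultimately have "((\<lambda>z. momentum_inverse (fst z) (snd z) - p) \<longlongrightarrow> 0) ?F"
    by (rule Lim_null_comparison)
  then show "((\<lambda>(x, y). momentum_inverse x y) \<longlongrightarrow> (\<lambda>(x, y). momentum_inverse x y) z0)
      (at z0 within M \<times> (- {0}))"
    by (simp add: z0 LIM_zero_iff p_def case_prod_unfold)
qed

lemma mixed_C_momentum_inverse: "mixed_C M (- {0}) k m (\<lambda>x y. momentum_inverse x y $ i)"
proof (rule mixed_C_implicit[where l = momentum_gradient])
  show "open (- {0 :: real^'n})" by (simp add: open_Compl)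
  show "mixed_C M (- {0}) k m (\<lambda>x p. momentum_gradient x p $ i)" for m i
    by (rule mixed_C_momentum_gradient)
  show "inj D" if "x \<in> M" "p \<in> - {0}" "(momentum_gradient x has_derivative D) (at p)" for x p D
    using momentum_gradient_nondegenerate that by simp
qed (simp_all add: momentum_inverse continuous_on_momentum_inverse)

text \<open>\<open>inv_into\<close> chooses some preimage; injectivity on
  \<open>M \<times> (- {0})\<close> forces it to be the one exhibited.\<close>

lemma finsler_qP_eq:
  assumes "x \<in> M" "y \<noteq> 0"
  shows "finsler_qP M c x y = sqrt (lambda_qP c x (momentum_inverse x y))"
proof -
  have "inj_on (legendre_qP c) (M \<times> (- {0}))"
  proof (rule inj_onI)
    fix z z' assume z: "z \<in> M \<times> (- {0})" "z' \<in> M \<times> (- {0})"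
      and eq: "legendre_qP c z = legendre_qP c z'"
    obtain w p w' p' where [simp]: "z = (w, p)" "z' = (w', p')" by (cases z; cases z')
    have "w = w'" and "momentum_gradient w p = momentum_gradient w' p'"
      using eq by (auto simp: legendre_qP_eq)
    with momentum_gradient_inj[of w p p'] z show "z = z'" by simp
  qed
  moreover have "(x, momentum_inverse x y) \<in> M \<times> (- {0})"
    using assms momentum_inverse by simp
  moreover have "legendre_qP c (x, momentum_inverse x y) = (x, y)"
    using momentum_inverse[OF assms] by (simp add: legendre_qP_eq)
  ultimately have "inv_into (M \<times> (- {0})) (legendre_qP c) (x, y) = (x, momentum_inverse x y)"
    by (rule inv_into_f_eq)
  then show ?thesis using assms(2) by (simp add: finsler_qP_def)
qed

lemma mixed_C_finsler_qP: "mixed_C M (- {0}) k m (finsler_qP M c)"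
proof (rule mixed_C_cong)
  show "mixed_C M (- {0}) k m (\<lambda>x y. sqrt (lambda_qP c x (momentum_inverse x y)))"
  proof (rule mixed_C_sqrt[OF mixed_C_compose[OF _ _ mixed_C_lambda_qP mixed_C_momentum_inverse]])
    show "lambda_qP c x (momentum_inverse x y) > 0" if "x \<in> M" "y \<in> - {0}" for x y
      using that momentum_inverse by (intro lambda_qP_pos) auto
  qed (use momentum_inverse in \<open>auto simp: open_Compl\<close>)
qed (auto simp: finsler_qP_eq open_Compl)

end

theorem theorem1:
  fixes M :: "(real^'n::finite) set"
    and c :: "real^'n \<Rightarrow> 'n tensor4"
    and k :: nat
  assumes "k \<ge> 1"
    and "smooth_domain M"
    and "\<And>x. x \<in> M \<Longrightarrow> stiffness_tensor (c x)"
    and "\<And>x. x \<in> M \<Longrightarrow> positive_definite_tensor (c x)"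
    and "C_k_tensor_field k M c"
    and "qP_globally_separate M c"
  shows "C_aniso_inf k M (- {0}) (finsler_qP M c)"
proof -
  interpret separate_qP M c k by unfold_locales (fact assms)+
  show ?thesis
    by (rule C_aniso_inf_if_mixed_C[OF _ smooth_domain_unique_derivatives[OF assms(2)] mixed_C_finsler_qP])
      (simp add: open_Compl)
qed

end
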